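(* Let $\Gamma$ be a connected negative definite plumbing tree with all genera zero, with $\det(-I)=1$ (i.e. $L=L'$, $H=0$), and with non-empty set of nodes $\mathcal N$. Let $\mathcal C$ be any chamber associated with the denominator of $Z$ such that $\mathrm{int}(\mathcal C\cap\mathcal S)\neq\emptyset$, and let $\widehat{\mathfrak a}^{\mathcal C}_{(m_n)_n}$ be the normalized coefficients of the Ehrhart quasipolynomial $\widehat{\mathcal L}^{\mathcal C}((\lambda_n)_n)$ defined in the context. Put $J_{nm}=-(E_n^*,E_m^* )$ for $n,m\in\mathcal N$. Then, for all $n\in\mathcal N$ and all $m\in\mathcal N$ with $m\ne n$: $$\widehat{\mathfrak a}^{\mathcal C}_{(\delta_n,(\delta_q-2)_{q\neq n})}=J_{nn},$$ $$\widehat{\mathfrak a}^{\mathcal C}_{(\delta_n-1,\,\delta_m-1,\,(\delta_q-2)_{q\neq n,m})}=J_{nm},$$ $$\widehat{\mathfrak a}^{\mathcal C}_{(\delta_n-1,(\delta_q-2)_{q\neq n})}=-\tfrac12 (K,E_n^* )+\tfrac12\sum_{q\in\mathcal N}(\delta_q-2)J_{nq},$$ and $$\widehat{\mathfrak a}^{\mathcal C}_{(\delta_n-2)_{n}}=\mathrm{pc}^{\mathcal S}(Z)-\sum_{n\in\mathcal N}\frac{(\delta_n-2)(K,E_n^* )}{4}+\sum_{n\in\mathcal N}\frac{(\delta_n-2)(3\delta_n-7)J_{nn}}{24}+\sum_{n,m\in\mathcal N,\ m\neq n}\frac{(\delta_n-2)(\delta_m-2)J_{nm}}{8},$$ where the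 last sum runs over ordered pairs. Here $(\delta_n,(\delta_q-2)_{q\ne n})$ denotes the multi-index with entry $\delta_n$ at $n$ and $\delta_q-2$ at every other node $q$, and similarly for the other multi-indices.
   Context: **Graph.** $\Gamma$ is a connected tree with vertex set $\mathcal V$, all genera $0$, integer vertex decorations, and negative definite intersection form $I=(\,,\,)$ on $L=\bigoplus_{v\in\mathcal V}\mathbb Z E_v$ ($(E_v,E_v)$ is the decoration; for $v\neq w$, $(E_v,E_w)=1$ if $v,w$ are adjacent and $0$ otherwise). $L'=\{l'\in L\otimes\mathbb Q: (l',L)\subset\mathbb Z\}$; here $L'=L$. $E_v^*\in L'$ is defined by $(E_v^*,E_w)=-1$ if $v=w$ and $0$ otherwise. $\delta_v$ is the valency of $v$; nodes are $\mathcal N=\{v:\delta_v\ge3\}$, ends are $\mathcal E=\{v:\delta_v=1\}$, so $|\mathcal E|=2+\sum_{n\in\mathcal N}(\delta_n-2)$. $K\in L'$ is the canonical class, determined by $(K+E_v,E_v)+2=0$ for all $v$. $\mathcal S=\{x\in L\otimes\mathbb R:(x,E_v)\le0\ \forall v\}$ is the (real) Lipman cone. The partial order: $l_1\ge l_2$ iff all $E_v$-coordinates of $l_1-l_2$ are $\ge0$. **Series.** For $l=\sum l_vE_v$ put $\mathbf t^{l}=\prod_v t_v^{l_v}$. $Z(\mathbf t)=\sum_l p_l\mathbf t^l$ is the Taylor expansion at the origin of $\prod_{v\in\mathcal V}(1-\mathbf t^{E_v^*})^{\delta_v-2}$. Its denominator is $\prod_{v\in\mathcal E}(1-\mathbf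 t^{E_v^*})$. Counting function: $Q(l)=\sum_{l''\not\ge l}p_{l''}$ (a finite sum). **Quasipolynomial.** A function on a lattice which is polynomial on each coset of some finite index sublattice; equivalently a polynomial expression whose coefficients are periodic functions. **Periodic constant.** If there exist $l_*\in\mathcal S$, a finite index sublattice $\widetilde L\subset L$ and a quasipolynomial $\widetilde Q$ on $\widetilde L$ with $Q(l)=\widetilde Q(l)$ for all $l\in\widetilde L\cap(l_*+\mathcal S)$, then $\mathrm{pc}^{\mathcal S}(Z):=\widetilde Q(0)$ (this exists for $Z$). **Chambers.** Consider the vectors $\{E_v^*\}_{v\in\mathcal E}\cup\{-E_v\}_{v\in\mathcal V}$ in $L\otimes\mathbb R$. For each subset forming a basis of $L\otimes\mathbb R$ take the closed positive cone it generates; the common refinement of all these cones is a polyhedral subdivision of $L\otimes\mathbb R$, and a chamber is a closed cone of it with non-empty interior. **Ehrhart quasipolynomial.** For $l\in L$ let $\mathcal L(l)=\#\{x\in(\mathbb Z_{\ge0})^{\mathcal E}:\sum_{e\in\mathcal E}x_eE_e^*\not\ge l\}$. For a chamber $\mathcal C$ there is a unique quasipolynomial $\mathcal L^{\mathcal C}$ on $L$ agreeing with $\mathcal L$ on $\mathcal C\cap L$. For $(\lambda_n)_{n\in\mathcal N}\in\mathbb Z^{\mathcal N}$ put $\widehat{\mathcal L}^{\mathcal C}((\lambda_n)_n)=\mathcal L^{\mathcal C}\big(\sum_{n\in\mathcal N}\lambda_nE_n^*\big)$, and write it as $$\widehat{\mathcal L}^{\mathcal C}((\lambda_n)_n)=\sum_{m_n\ge0,\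 \sum_n m_n\le|\mathcal E|}\widehat{\mathfrak a}^{\mathcal C}_{(m_n)_n}\prod_{n\in\mathcal N}\frac{\lambda_n^{m_n}}{m_n!},$$ where the $\widehat{\mathfrak a}^{\mathcal C}_{(m_n)_n}$ are a priori periodic functions of $(\lambda_n)_n$. *)

theory Defs
  imports "HOL-Analysis.Analysis" "HOL-Computational_Algebra.Formal_Power_Series"
begin

text \<open>
  The vertex set is a finite type \<open>'v\<close> and the space spanned by the classes \<open>E\<^sub>v\<close> over the
  reals is \<open>real ^ 'v\<close>, with \<open>E\<^sub>v = axis v 1\<close>. The library's componentwise order on \<open>real ^ 'v\<close>
  is the partial order of the coordinates. All genera are zero, so no genera are recorded; this
  enters the adjunction relation that determines the canonical class.
\<close>

record 'v plumbing_graph =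
  adj :: "'v \<Rightarrow> 'v \<Rightarrow> bool"
  decoration :: "'v \<Rightarrow> int"

definition has_cycle :: "('v \<Rightarrow> 'v \<Rightarrow> bool) \<Rightarrow> bool" where
  "has_cycle R \<longleftrightarrow> (\<exists>vs. 3 \<le> length vs \<and> distinct vs \<and>
     (\<forall>i<length vs. R (vs ! i) (vs ! (Suc i mod length vs))))"

definition is_tree :: "'v plumbing_graph \<Rightarrow> bool" where
  "is_tree G \<longleftrightarrow> symp (adj G) \<and> irreflp (adj G) \<and> (\<forall>u v. (adj G)\<^sup>*\<^sup>* u v) \<and> \<not> has_cycle (adj G)"

definition valency :: "'v plumbing_graph \<Rightarrow> 'v \<Rightarrow> nat" where
  "valency G v = card {w. adj G v w}"

definition nodes :: "'v plumbing_graph \<Rightarrow> 'v set" where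
  "nodes G = {v. valency G v \<ge> 3}"

definition ends :: "'v plumbing_graph \<Rightarrow> 'v set" where
  "ends G = {v. valency G v = 1}"

definition intersection_matrix :: "'v::finite plumbing_graph \<Rightarrow> real ^ 'v ^ 'v" where
  "intersection_matrix G =
     (\<chi> v w. if v = w then of_int (decoration G v) else if adj G v w then 1 else 0)"

definition form :: "'v::finite plumbing_graph \<Rightarrow> real ^ 'v \<Rightarrow> real ^ 'v \<Rightarrow> real" where
  "form G x y = x \<bullet> (intersection_matrix G *v y)"

definition negative_definite :: "'v::finite plumbing_graph \<Rightarrow> bool" where
  "negative_definite G \<longleftrightarrow> (\<forall>x. x \<noteq> 0 \<longrightarrow> form G x x < 0)"

definition E :: "'v::finite \<Rightarrow> real ^ 'v" where
  "E v = axis v 1"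

text \<open>
  The form is nondegenerate, so the following two descriptions have exactly one solution in
  \<open>real ^ 'v\<close>; it lies in the dual lattice, hence in the lattice itself if that is unimodular.
\<close>

definition Estar :: "'v::finite plumbing_graph \<Rightarrow> 'v \<Rightarrow> real ^ 'v" where
  "Estar G v = (THE x. \<forall>w. form G x (E w) = (if v = w then -1 else 0))"

definition canonical_class :: "'v::finite plumbing_graph \<Rightarrow> real ^ 'v" where
  "canonical_class G = (THE k. \<forall>v. form G (k + E v) (E v) + 2 = 0)"

definition lipman_cone :: "'v::finite plumbing_graph \<Rightarrow> (real ^ 'v) set" where
  "lipman_cone G = {x. \<forall>v. form G x (E v) \<le> 0}"

definition lattice :: "(real ^ 'v) set" where
  "lattice = {x. \<forall>v. x $ v \<in> \<int>}"

text \<open>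
  The coefficients \<open>p\<^sub>l\<close> of the Taylor expansion \<open>Z\<close>. The factor at \<open>v\<close> is the power series of
  \<open>(1 - T) powi (\<delta>\<^sub>v - 2)\<close> evaluated at \<open>T = t\<^sup>a\<close> with \<open>a = Estar G v\<close>, and the product of the
  factors is the Cauchy product. The exponents \<open>Estar G v\<close> are linearly independent, so the index
  set of the sum has at most one element.
\<close>

definition Z_coeff :: "'v::finite plumbing_graph \<Rightarrow> real ^ 'v \<Rightarrow> real" where
  "Z_coeff G l =
     (\<Sum>k | (\<Sum>v\<in>UNIV. real (k v) *\<^sub>R Estar G v) = l.
        \<Prod>v\<in>UNIV. fps_nth ((1 - fps_X) powi (int (valency G v) - 2)) (k v))"

text \<open>Only finitely many \<open>l''\<close> with \<open>l'' \<ge> l\<close> failing carry a nonzero coefficient.\<close>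

definition counting_function ::
    "(real ^ 'v \<Rightarrow> real) \<Rightarrow> real ^ 'v::finite \<Rightarrow> real" where
  "counting_function p l = (\<Sum>l'' | \<not> l \<le> l'' \<and> p l'' \<noteq> 0. p l'')"

definition finite_index_sublattice :: "'a::ab_group_add set \<Rightarrow> 'a set \<Rightarrow> bool" where
  "finite_index_sublattice M L \<longleftrightarrow>
     M \<subseteq> L \<and> 0 \<in> M \<and> (\<forall>x\<in>M. \<forall>y\<in>M. x - y \<in> M) \<and> finite ((\<lambda>a. (+) a ` M) ` L)"

definition quasipolynomial_on :: "'a::real_normed_vector set \<Rightarrow> ('a \<Rightarrow> real) \<Rightarrow> bool" where
  "quasipolynomial_on L f \<longleftrightarrow>
     (\<exists>M. finite_index_sublattice M L \<and>
       (\<forall>a\<in>L. \<exists>P. real_polynomial_function P \<and> (\<forall>x\<in>M. f (a + x) = P (a + x))))"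

definition periodic_on :: "'a::ab_group_add set \<Rightarrow> ('a \<Rightarrow> real) \<Rightarrow> bool" where
  "periodic_on L f \<longleftrightarrow>
     (\<exists>M. finite_index_sublattice M L \<and> (\<forall>x\<in>L. \<forall>y\<in>M. f (x + y) = f x))"

definition is_periodic_constant ::
    "(real ^ 'v) set \<Rightarrow> (real ^ 'v \<Rightarrow> real) \<Rightarrow> real \<Rightarrow> bool" where
  "is_periodic_constant S p c \<longleftrightarrow>
     (\<exists>l0 L' Q'. l0 \<in> S \<and> finite_index_sublattice L' lattice \<and> quasipolynomial_on L' Q' \<and>
        (\<forall>l \<in> L' \<inter> (+) l0 ` S. counting_function p l = Q' l) \<and> c = Q' 0)"

definition periodic_constant :: "(real ^ 'v) set \<Rightarrow> (real ^ 'v::finite \<Rightarrow> real) \<Rightarrow> real" where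
  "periodic_constant S p = (THE c. is_periodic_constant S p c)"

definition basis_cones :: "'v::finite plumbing_graph \<Rightarrow> (real ^ 'v) set set" where
  "basis_cones G =
     {convex_cone hull B | B. B \<subseteq> Estar G ` ends G \<union> range (\<lambda>v. - E v) \<and>
        independent B \<and> span B = UNIV}"

text \<open>
  A full-dimensional cell of the common refinement of the basis cones is an intersection of some of
  these cones into which none of them cuts: each basis cone either contains the cell or has
  interior disjoint from the interior of the cell.
\<close>

definition is_chamber :: "'v::finite plumbing_graph \<Rightarrow> (real ^ 'v) set \<Rightarrow> bool" where
  "is_chamber G C \<longleftrightarrow>
     (\<exists>F. F \<noteq> {} \<and> F \<subseteq> basis_cones G \<and> C = \<Inter>F) \<and> interior C \<noteq> {} \<and>
     (\<forall>D\<in>basis_cones G. C \<subseteq> D \<or> interior C \<inter> interior D = {})"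

definition ehrhart_count :: "'v::finite plumbing_graph \<Rightarrow> real ^ 'v \<Rightarrow> nat" where
  "ehrhart_count G l =
     card {x \<in> ends G \<rightarrow>\<^sub>E (UNIV :: nat set). \<not> l \<le> (\<Sum>e\<in>ends G. real (x e) *\<^sub>R Estar G e)}"

text \<open>
  A chamber has interior points, so the following determines the values of \<open>f\<close> on the lattice.
\<close>

definition is_ehrhart_quasipolynomial ::
    "'v::finite plumbing_graph \<Rightarrow> (real ^ 'v) set \<Rightarrow> (real ^ 'v \<Rightarrow> real) \<Rightarrow> bool" where
  "is_ehrhart_quasipolynomial G C f \<longleftrightarrow>
     quasipolynomial_on lattice f \<and> (\<forall>l \<in> C \<inter> lattice. f l = real (ehrhart_count G l))"

text \<open>
  Families indexed by the nodes are represented by families indexed by all vertices that vanish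
  off the nodes, both for the integer arguments and for the multi-indices.
\<close>

definition node_lattice :: "'v::finite plumbing_graph \<Rightarrow> (real ^ 'v) set" where
  "node_lattice G = {x \<in> lattice. \<forall>v. v \<notin> nodes G \<longrightarrow> x $ v = 0}"

definition multi_indices :: "'v::finite plumbing_graph \<Rightarrow> ('v \<Rightarrow> nat) set" where
  "multi_indices G =
     {m. (\<forall>v. v \<notin> nodes G \<longrightarrow> m v = 0) \<and> (\<Sum>n\<in>nodes G. m n) \<le> card (ends G)}"

definition restrict_to_nodes ::
    "'v::finite plumbing_graph \<Rightarrow> (real ^ 'v \<Rightarrow> real) \<Rightarrow> real ^ 'v \<Rightarrow> real" where
  "restrict_to_nodes G f x = f (\<Sum>n\<in>nodes G. (x $ n) *\<^sub>R Estar G n)"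

definition normalized_coefficients ::
    "'v::finite plumbing_graph \<Rightarrow> (real ^ 'v \<Rightarrow> real) \<Rightarrow> (('v \<Rightarrow> nat) \<Rightarrow> real ^ 'v \<Rightarrow> real) \<Rightarrow> bool"
  where
  "normalized_coefficients G f a \<longleftrightarrow>
     (\<forall>m\<in>multi_indices G. periodic_on (node_lattice G) (a m)) \<and>
     (\<forall>x\<in>node_lattice G. f x =
        (\<Sum>m\<in>multi_indices G. a m x * (\<Prod>n\<in>nodes G. (x $ n) ^ m n / fact (m n))))"

text \<open>The multi-index with entry \<open>\<delta>\<^sub>q - 2\<close> at every node \<open>q\<close>.\<close>

definition base_index :: "'v::finite plumbing_graph \<Rightarrow> 'v \<Rightarrow> nat" where
  "base_index G q = (if q \<in> nodes G then valency G q - 2 else 0)"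

definition J :: "'v::finite plumbing_graph \<Rightarrow> 'v \<Rightarrow> 'v \<Rightarrow> real" where
  "J G n m = - form G (Estar G n) (Estar G m)"

end

theory Submission
  imports Defs
begin

text \<open>
  Write \<open>k\<^sub>u(l) = -(l, E\<^sub>u)\<close>. The coefficient of \<open>Z\<close> at \<open>l\<close> is a product over the vertices of
  coefficients of \<open>(1 - T)^(\<delta>\<^sub>u - 2)\<close> at \<open>T^k\<^sub>u(l)\<close>, so
  \<open>Q(l + E\<^sub>v) - Q(l)\<close>, the sum of these coefficients over \<open>l + y\<close> with \<open>y \<ge> 0\<close> and \<open>y\<^sub>v = 0\<close>, can be
  evaluated by summing out leaves one after the other. For \<open>l\<close> deep in the Lipman cone each
  branch at \<open>v\<close> contributes \<open>1 / (1 - T)\<close>, whence the sum is the coefficient of \<open>(1 - T)^(-2)\<close> at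
  \<open>T^k\<^sub>v(l)\<close>, that is, \<open>1 + k\<^sub>v(l) = \<chi>(l + E\<^sub>v) - \<chi>(l)\<close> with \<open>\<chi>(l) = -(l, l + K) / 2\<close>. Hence
  \<open>Q = \<chi> + pc\<close> deep in the cone. On the other hand \<open>Q\<close> arises from the Ehrhart count by taking
  \<open>\<delta>\<^sub>n - 2\<close> backward differences in the direction of \<open>E\<^sub>n\<^sup>*\<close> for every node \<open>n\<close>. Thus these
  differences of the Ehrhart quasipolynomial are \<open>\<chi> + pc\<close> on the whole lattice, and this
  determines the coefficients whose multi-index is at least \<open>\<delta>\<^sub>n - 2\<close> at every node.
\<close>

section \<open>Summation over a tree\<close>

text \<open>A branch summed out at \<open>u\<close> is a power series that depends on the value
  \<open>y u\<close>, and it equals \<open>1 / (1 - X)\<close> only from some degree on. The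
  induction over the tree therefore carries a bound on that degree which is linear in
  \<open>y u\<close>, so that the defect disappears at the root, where \<open>y v = 0\<close>. The
  slopes of these bounds are ratios of coordinates of \<open>Estar G v\<close>: this vector is
  positive, and its charges vanish off \<open>v\<close>, which gives the inequality that passes a
  bound from a leaf to its neighbour.

  Neither quasipolynomiality nor periodicity is handled on cosets. Two functions that agree far out
  in a cone are compared along rays whose step lies in the period lattice, where they are
  polynomials in one variable; the starting point of the ray is arbitrary, so the equality reaches
  every lattice point.

  The coefficients of the Ehrhart quasipolynomial are only periodic, so unit differences do not
  isolate them. An explicit polynomial with the same unit differences is subtracted, and the
  remainder is tested with longer steps.\<close>

definition int_nth :: "real fps \<Rightarrow> int \<Rightarrow> real" where
  "int_nth F z = (if z < 0 then 0 else fps_nth F (nat z))"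

text \<open>Equivalently, \<open>(1 - X) F\<close> is a polynomial of degree at most
  \<open>d\<close> whose value at \<open>X = 1\<close> is 1. The number \<open>d\<close> measures
  the defect of \<open>F\<close> against \<open>1 / (1 - X)\<close>.\<close>

definition one_from :: "real fps \<Rightarrow> nat \<Rightarrow> bool" where
  "one_from F d \<longleftrightarrow> (\<forall>n\<ge>d. fps_nth F n = 1)"

lemma sum_nth_one_minus_X_mult:
  "(\<Sum>i\<le>n. fps_nth ((1 - fps_X) * F) i) = fps_nth (F :: real fps) n"
proof (induction n)
  case 0
  then show ?case by simp
next
  case (Suc n)
  have "fps_nth ((1 - fps_X) * F) (Suc n) = fps_nth F (Suc n) - fps_nth F n"
    by (simp add: left_diff_distrib)
  with Suc show ?case by simp
qed

text \<open>\<open>(1 - X) A\<close> has no coefficients beyond degree \<open>a\<close>, and they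
  add up to 1. From degree \<open>a + b\<close> on, the convolution with \<open>B\<close> meets only
  coefficients of \<open>B\<close> equal to 1 and returns this sum. Hence the defects of branches
  glued at a vertex add up.\<close>

lemma one_from_mult:
  assumes "one_from A a" "one_from B b"
  shows "one_from ((1 - fps_X) * A * B) (a + b)"
  unfolding one_from_def
proof (intro allI impI)
  fix n assume n: "a + b \<le> n"
  let ?P = "(1 - fps_X) * A"
  have zero: "fps_nth ?P i = 0" if ai: "a < i" for i
  proof -
    obtain j where j: "i = Suc j" using ai by (cases i) auto
    with ai have "a \<le> j" by simp
    with j show ?thesis using assms(1) by (simp add: left_diff_distrib one_from_def)
  qed
  have "fps_nth (?P * B) n = (\<Sum>i=0..n. fps_nth ?P i * fps_nth B (n - i))"
    by (simp only: fps_mult_nth)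
  also have "\<dots> = (\<Sum>i\<in>{..a}. fps_nth ?P i * fps_nth B (n - i))"
    by (rule sum.mono_neutral_right) (use n zero in auto)
  also have "\<dots> = (\<Sum>i\<le>a. fps_nth ?P i)"
    by (rule sum.cong) (use n assms(2) in \<open>auto simp: one_from_def\<close>)
  also have "\<dots> = 1"
    using assms(1) by (simp add: sum_nth_one_minus_X_mult one_from_def)
  finally show "fps_nth (?P * B) n = 1" .
qed

text \<open>This is how the sum over the value at a leaf occurs: \<open>A\<close> is indexed by that
  value, and \<open>B\<close> belongs to the neighbour, whose charge drops by it.\<close>

lemma int_nth_mult:
  assumes "0 \<le> z"
  shows "(\<Sum>i\<le>nat z. fps_nth A i * int_nth B (z - int i)) = int_nth (A * B) z"
proof -
  have "(\<Sum>i\<le>nat z. fps_nth A i * int_nth B (z - int i))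
      = (\<Sum>i\<le>nat z. fps_nth A i * fps_nth B (nat z - i))"
    by (rule sum.cong) (use assms in \<open>auto simp: int_nth_def nat_diff_distrib'\<close>)
  then show ?thesis
    using assms by (simp add: int_nth_def fps_mult_nth atLeast0AtMost)
qed

lemma inverse_one_minus_X_cancel:
  "inverse (1 - fps_X) * (1 - fps_X) = (1 :: real fps)"
  by (rule inverse_mult_eq_1) simp

lemma fps_nth_inverse_one_minus_X: "fps_nth (inverse (1 - fps_X)) n = (1 :: real)"
proof -
  have "inverse (1 - fps_X) = (Abs_fps (\<lambda>_. 1) :: real fps)"
    by (rule fps_inverse_unique) (simp add: fps_eq_iff left_diff_distrib)
  then show ?thesis by simp
qed

text \<open>Growth by leaves: the new vertex has exactly one neighbour among those present. Read
  backwards, this is the order in which leaves are summed out, with the root left to the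
  end.\<close>

inductive rooted_tree :: "('v \<Rightarrow> 'v \<Rightarrow> bool) \<Rightarrow> 'v \<Rightarrow> 'v set \<Rightarrow> bool" for R v where
  root: "rooted_tree R v {v}"
| grow: "rooted_tree R v W \<Longrightarrow> c \<notin> W \<Longrightarrow> u \<in> W \<Longrightarrow> R u c \<Longrightarrow> (\<forall>w\<in>W. R w c \<longrightarrow> w = u)
    \<Longrightarrow> rooted_tree R v (insert c W)"

lemma rooted_tree_root: "rooted_tree R v W \<Longrightarrow> v \<in> W"
  by (induction rule: rooted_tree.induct) auto

lemma rooted_tree_finite: "rooted_tree R v W \<Longrightarrow> finite W"
  by (induction rule: rooted_tree.induct) auto

lemma neighbours_insert:
  assumes "symp R" "irreflp R" "c \<notin> W" "u \<in> W" "R u c" "\<forall>w\<in>W. R w c \<longrightarrow> w = u"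
  shows "{w \<in> insert c W. R c w} = {u}"
    and "{w \<in> insert c W. R u w} = insert c {w \<in> W. R u w}"
    and "x \<in> W \<Longrightarrow> x \<noteq> u \<Longrightarrow> {w \<in> insert c W. R x w} = {w \<in> W. R x w}"
proof -
  have sym: "R x y = R y x" for x y using assms(1) by (blast dest: sympD)
  have irr: "\<not> R x x" for x using assms(2) by (simp add: irreflpD)
  show "{w \<in> insert c W. R c w} = {u}"
    using assms(3-6) irr[of c] sym[of c] by blast
  show "{w \<in> insert c W. R u w} = insert c {w \<in> W. R u w}"
    using assms(3-6) by blast
  show "x \<in> W \<Longrightarrow> x \<noteq> u \<Longrightarrow> {w \<in> insert c W. R x w} = {w \<in> W. R x w}"
    using assms(3-6) by blast
qed

lemma sum_degrees_rooted_tree: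
  assumes "symp R" "irreflp R" "rooted_tree R v W"
  shows "(\<Sum>u\<in>W. card {w \<in> W. R u w}) + 2 = 2 * card W"
  using assms(3)
proof (induction rule: rooted_tree.induct)
  case root
  have "{w. w = v \<and> R v w} = {}" using irreflpD[OF assms(2), of v] by blast
  then show ?case by simp
next
  case (grow W c u)
  note nb = neighbours_insert[OF assms(1,2) grow.hyps(2-5)]
  have fin: "finite W" using grow.hyps(1) by (rule rooted_tree_finite)
  have "(\<Sum>x\<in>insert c W. card {w \<in> insert c W. R x w})
      = 1 + (\<Sum>x\<in>W. card {w \<in> insert c W. R x w})"
    using fin grow.hyps(2) by (subst sum.insert) (auto simp: nb(1) simp del: insert_iff)
  also have "(\<Sum>x\<in>W. card {w \<in> insert c W. R x w})
      = (\<Sum>x\<in>W. card {w \<in> W. R x w} + (if x = u then 1 else 0))"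
  proof (rule sum.cong[OF refl])
    fix x assume "x \<in> W"
    then show "card {w \<in> insert c W. R x w} = card {w \<in> W. R x w} + (if x = u then 1 else 0)"
      using fin grow.hyps(2) nb(3)[of x] by (cases "x = u") (simp_all add: nb(2) del: insert_iff)
  qed
  also have "\<dots> = (\<Sum>x\<in>W. card {w \<in> W. R x w}) + 1"
    using fin grow.hyps(2-4) by (simp add: sum.distrib)
  finally show ?case using grow.IH fin grow.hyps(2-4) by simp
qed

lemma rooted_tree_path:
  assumes "symp R" "rooted_tree R v W" "x \<in> W" "y \<in> W"
  shows "\<exists>p. p \<noteq> [] \<and> distinct p \<and> set p \<subseteq> W \<and> hd p = x \<and> last p = y \<and> successively R p"
  using assms(2-4)
proof (induction arbitrary: x y rule: rooted_tree.induct)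
  case root
  then show ?case by (intro exI[of _ "[v]"]) auto
next
  case (grow W c u)
  have *: "\<exists>p. p \<noteq> [] \<and> distinct p \<and> set p \<subseteq> insert c W \<and> hd p = x \<and> last p = y \<and> successively R p"
    if "x \<in> W" "y \<in> W" for x y
    using grow.IH[OF that] by blast
  show ?case
  proof (cases "x = c")
    case True
    show ?thesis
    proof (cases "y = c")
      case True
      then show ?thesis using \<open>x = c\<close> by (intro exI[of _ "[c]"]) auto
    next
      case False
      then obtain p where "p \<noteq> []" "distinct p" "set p \<subseteq> W" "hd p = u" "last p = y" "successively R p"
        using grow.IH[of u y] grow.prems grow.hyps(2-4) by auto
      then show ?thesis using \<open>x = c\<close> grow.hyps(2) sympD[OF assms(1) grow.hyps(4)]
        by (intro exI[of _ "c # p"]) (auto simp: successively_Cons)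
    qed
  next
    case False
    show ?thesis
    proof (cases "y = c")
      case True
      obtain p where "p \<noteq> []" "distinct p" "set p \<subseteq> W" "hd p = x" "last p = u" "successively R p"
        using grow.IH[of x u] grow.prems grow.hyps(2-4) False by auto
      then show ?thesis using \<open>y = c\<close> grow.hyps(2-4)
        by (intro exI[of _ "p @ [c]"]) (auto simp: successively_append_iff)
    next
      case False
      then show ?thesis using * grow.prems \<open>x \<noteq> c\<close> by auto
    qed
  qed
qed

text \<open>A largest grown set \<open>W\<close> is closed under adjacency: an outside vertex with a
  single neighbour in \<open>W\<close> could be added, and one with two neighbours would close a
  path in \<open>W\<close> to a cycle. Connectedness does the rest.\<close>

lemma rooted_tree_UNIV:
  fixes G :: "'v::finite plumbing_graph"
  assumes "is_tree G"
  shows "rooted_tree (adj G) v UNIV"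
proof -
  have sym: "symp (adj G)" and conn: "(adj G)\<^sup>*\<^sup>* x y" and nocyc: "\<not> has_cycle (adj G)" for x y
    using assms by (auto simp: is_tree_def)
  define W where "W = (ARG_MAX card W. rooted_tree (adj G) v W)"
  have W: "rooted_tree (adj G) v W" and max: "rooted_tree (adj G) v W' \<Longrightarrow> card W' \<le> card W" for W'
  proof -
    have "\<forall>W. rooted_tree (adj G) v W \<longrightarrow> card W < Suc (card (UNIV :: 'v set))"
      by (auto intro: card_mono simp: less_Suc_eq_le)
    from arg_max_nat_lemma[of "rooted_tree (adj G) v", OF rooted_tree.root this]
    show "rooted_tree (adj G) v W" and "rooted_tree (adj G) v W' \<Longrightarrow> card W' \<le> card W"
      unfolding W_def by auto
  qed
  have closed: "c \<in> W" if "u \<in> W" "adj G u c" for u c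
  proof (rule ccontr)
    assume c: "c \<notin> W"
    have "w = u" if "w \<in> W" "adj G w c" for w
    proof (rule ccontr)
      assume "w \<noteq> u"
      obtain p where p: "p \<noteq> []" "distinct p" "set p \<subseteq> W" "hd p = u" "last p = w" "successively (adj G) p"
        using rooted_tree_path[OF sym W \<open>u \<in> W\<close> \<open>w \<in> W\<close>] by blast
      have len: "2 \<le> length p"
        using p \<open>w \<noteq> u\<close> by (cases p; cases "tl p") auto
      have "has_cycle (adj G)"
        unfolding has_cycle_def
      proof (intro exI conjI allI impI)
        show "3 \<le> length (c # p)" using len by simp
        show "distinct (c # p)" using p c by auto
        fix i assume i: "i < length (c # p)"
        show "adj G ((c # p) ! i) ((c # p) ! (Suc i mod length (c # p)))"
        proof (cases "i = length p")
          case True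
          then have "(c # p) ! i = w" using p by (simp add: nth_Cons' last_conv_nth)
          then show ?thesis using \<open>adj G w c\<close> True by simp
        next
          case False
          then have "i < length p" using i by simp
          show ?thesis
          proof (cases i)
            case 0
            then show ?thesis
              using p \<open>adj G u c\<close> sympD[OF sym, of u c] \<open>i < length p\<close> by (auto simp: hd_conv_nth)
          next
            case (Suc j)
            then show ?thesis
              using p(6) \<open>i < length p\<close> by (simp add: successively_conv_nth)
          qed
        qed
      qed
      with nocyc show False ..
    qed
    then have "rooted_tree (adj G) v (insert c W)"
      using rooted_tree.grow[OF W c \<open>u \<in> W\<close> \<open>adj G u c\<close>] by blast
    from max[OF this] show False using c by simp
  qed
  have "y \<in> W" for y
    using conn[of v y] by (induction rule: rtranclp_induct) (use rooted_tree_root[OF W] closed in auto)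
  then have "W = UNIV" by auto
  with W show ?thesis by simp
qed

text \<open>The charge of \<open>l + y\<close> at \<open>u\<close> for \<open>y\<close> supported on
  \<open>W\<close>, where \<open>k\<close> holds the charges of \<open>l\<close> and
  \<open>b\<close> the negated decorations.\<close>

definition charge :: "('v \<Rightarrow> 'v \<Rightarrow> bool) \<Rightarrow> ('v \<Rightarrow> int) \<Rightarrow> ('v \<Rightarrow> int) \<Rightarrow> 'v set \<Rightarrow> ('v \<Rightarrow> nat) \<Rightarrow> 'v \<Rightarrow> int" where
  "charge R b k W y u = k u + b u * int (y u) - (\<Sum>w | w \<in> W \<and> R u w. int (y w))"

text \<open>The root coordinate is pinned to 0 because the increment of \<open>Q\<close> in
  direction \<open>E v\<close> is being computed. Charges serve as exponents of one-variable power
  series, hence the sign condition.\<close>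

definition admissible :: "('v \<Rightarrow> 'v \<Rightarrow> bool) \<Rightarrow> ('v \<Rightarrow> int) \<Rightarrow> ('v \<Rightarrow> int) \<Rightarrow> 'v \<Rightarrow> 'v set \<Rightarrow> ('v \<Rightarrow> nat) set" where
  "admissible R b k v W = {y \<in> W \<rightarrow>\<^sub>E UNIV. y v = 0 \<and> (\<forall>u\<in>W. 0 \<le> charge R b k W y u)}"

text \<open>
  The vertex factors carry the power series obtained by summing out branches already removed.
  The positive vector \<open>e\<close> bounds the degree up to which such a series can differ from
  \<open>1 / (1 - X)\<close>.
\<close>

lemma tree_sum:
  fixes e \<gamma> :: "'v \<Rightarrow> real" and b k :: "'v \<Rightarrow> int" and H :: "'v \<Rightarrow> nat \<Rightarrow> real fps"
  assumes sym: "symp R" and irr: "irreflp R"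
    and e: "\<And>u. 0 < e u" and k0: "\<And>u. 0 \<le> k u"
    and deep: "\<And>u w. u \<noteq> v \<Longrightarrow> R u w \<Longrightarrow> e w \<le> of_int (k u) * e u"
    and tree: "rooted_tree R v W"
    and H: "\<And>u y. u \<in> W \<Longrightarrow> \<exists>d. real d \<le> \<gamma> u * real y \<and> one_from (H u y) d"
    and super: "\<And>u. u \<in> W \<Longrightarrow> u \<noteq> v \<Longrightarrow> (\<Sum>w | w \<in> W \<and> R u w. e w) \<le> (of_int (b u) - \<gamma> u) * e u"
  shows "finite (admissible R b k v W) \<and>
    (\<Sum>y\<in>admissible R b k v W. \<Prod>u\<in>W.
       int_nth (inverse (1 - fps_X) * (1 - fps_X) ^ card {w \<in> W. R u w} * H u (y u)) (charge R b k W y u))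
    = of_int (k v) + 1"
  using tree H super
proof (induction arbitrary: H \<gamma> rule: rooted_tree.induct)
  case root
  have nb: "{w. w = v \<and> R v w} = {}" using irreflpD[OF irr, of v] by blast
  have "y \<in> admissible R b k v {v} \<longleftrightarrow> y = (\<lambda>x\<in>{v}. 0)" for y
  proof
    assume "y \<in> admissible R b k v {v}"
    then show "y = (\<lambda>x\<in>{v}. 0)" by (auto simp: admissible_def fun_eq_iff PiE_iff extensional_def)
  next
    assume "y = (\<lambda>x\<in>{v}. 0)"
    then show "y \<in> admissible R b k v {v}" using nb k0 by (auto simp: admissible_def charge_def)
  qed
  then have adm: "admissible R b k v {v} = {\<lambda>x\<in>{v}. 0}" by auto
  \<comment> \<open>The bound on the defect is linear in \<open>y v = 0\<close>, so the series at
    the root is exactly \<open>1 / (1 - X)\<close>, and the coefficients of its square are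
    \<open>n + 1\<close>.\<close>
  obtain d where "real d \<le> \<gamma> v * real 0" "one_from (H v 0) d"
    using root(1)[of v 0] by auto
  then have "\<forall>n. fps_nth (H v 0) n = 1" by (auto simp: one_from_def)
  then have "fps_nth (inverse (1 - fps_X) * H v 0) n = real n + 1" for n
    by (simp add: fps_mult_nth fps_nth_inverse_one_minus_X)
  moreover have "card {w. w = v \<and> R v w} = 0" by (simp only: nb card.empty)
  ultimately show ?case using k0[of v] by (simp add: adm charge_def int_nth_def nb)
next
  case (grow W c u)
  note nb = neighbours_insert[OF sym irr grow.hyps(2-5)]
  have fin: "finite W" and v: "v \<in> W"
    using grow.hyps(1) by (rule rooted_tree_finite, rule rooted_tree_root)
  have cv: "c \<noteq> v" and uc: "u \<noteq> c" using v grow.hyps(2-4) by auto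
  have Rcu: "R c u" using grow.hyps(4) by (rule sympD[OF sym])
  \<comment> \<open>The factor of the leaf \<open>c\<close> as a generating function in
    \<open>z = y c\<close>, for the value \<open>s = y u\<close>. Since \<open>c\<close> has one
    neighbour, its powers of \<open>1 - X\<close> cancel and only \<open>H c z\<close> is
    left.\<close>
  define F where "F s = Abs_fps (\<lambda>z. int_nth (H c z) (k c + b c * int z - int s))" for s
  \<comment> \<open>Without \<open>c\<close>, the vertex \<open>u\<close> has one neighbour and
    hence one factor \<open>1 - X\<close> less; that factor is kept next to \<open>F\<close>. The
    defect of \<open>F s\<close> has slope \<open>e c / e u\<close>, which is added to the slope at
    \<open>u\<close>.\<close>
  define H' where "H' = H(u := \<lambda>s. (1 - fps_X) * F s * H u s)"
  define \<gamma>' where "\<gamma>' = \<gamma>(u := \<gamma> u + e c / e u)"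
  have superc: "e u \<le> (of_int (b c) - \<gamma> c) * e c"
    using grow.prems(2)[of c] nb(1) cv by simp
  have F: "one_from (F s) (nat \<lfloor>real s * (e c / e u)\<rfloor>)" for s
    unfolding one_from_def
  proof (intro allI impI)
    fix z assume "nat \<lfloor>real s * (e c / e u)\<rfloor> \<le> z"
    \<comment> \<open>Rounding down loses less than one unit of \<open>z\<close>, worth
      \<open>e u\<close> in the estimate. The depth assumption \<open>e u \<le> k c * e c\<close>
      pays for it.\<close>
    then have "real s * (e c / e u) < real z + 1" by linarith
    then have 1: "real s * e c < real z * e u + e u"
      using e[of u] by (simp add: field_simps)
    obtain d where d: "real d \<le> \<gamma> c * real z" "one_from (H c z) d"
      using grow.prems(1)[of c z] by auto
    have "real z * e u \<le> real z * ((of_int (b c) - \<gamma> c) * e c)"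
      using superc by (intro mult_left_mono) auto
    moreover have "real d * e c \<le> \<gamma> c * real z * e c"
      using d e[of c] by (intro mult_right_mono) (auto intro: less_imp_le)
    ultimately have "real s * e c < (of_int (k c) + of_int (b c) * real z - real d) * e c"
      using 1 deep[OF cv Rcu] by (simp add: algebra_simps)
    then have "real s < of_int (k c) + of_int (b c) * real z - real d"
      using e[of c] by simp
    then have "of_int (int s) < (of_int (k c + b c * int z - int d) :: real)" by simp
    then have "int s < k c + b c * int z - int d" by (simp only: of_int_less_iff)
    then show "fps_nth (F s) z = 1"
      using d(2) by (simp add: F_def int_nth_def one_from_def)
  qed
  have IH: "finite (admissible R b k v W) \<and>
    (\<Sum>y\<in>admissible R b k v W. \<Prod>x\<in>W.
       int_nth (inverse (1 - fps_X) * (1 - fps_X) ^ card {w \<in> W. R x w} * H' x (y x)) (charge R b k W y x))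
    = of_int (k v) + 1"
  proof (rule grow.IH[of \<gamma>' H'])
    fix x y assume x: "x \<in> W"
    show "\<exists>d. real d \<le> \<gamma>' x * real y \<and> one_from (H' x y) d"
    proof (cases "x = u")
      case True
      obtain d where d: "real d \<le> \<gamma> u * real y" "one_from (H u y) d"
        using grow.prems(1)[of u y] grow.hyps(2-4) by auto
      have "0 \<le> real y * (e c / e u)" using e[of c] e[of u] by simp
      then have "real (nat \<lfloor>real y * (e c / e u)\<rfloor> + d) \<le> \<gamma>' u * real y"
        using d by (simp add: \<gamma>'_def algebra_simps) linarith
      moreover have "one_from (H' u y) (nat \<lfloor>real y * (e c / e u)\<rfloor> + d)"
        using one_from_mult[OF F[of y] d(2)] by (simp add: H'_def)
      ultimately show ?thesis using True by blast
    next
      case False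
      then show ?thesis using grow.prems(1)[of x y] x by (simp add: H'_def \<gamma>'_def)
    qed
  next
    fix x assume x: "x \<in> W" "x \<noteq> v"
    show "(\<Sum>w | w \<in> W \<and> R x w. e w) \<le> (of_int (b x) - \<gamma>' x) * e x"
    proof (cases "x = u")
      case True
      have "(\<Sum>w | w \<in> insert c W \<and> R u w. e w) \<le> (of_int (b u) - \<gamma> u) * e u"
        using grow.prems(2)[of u] x True by blast
      moreover have "(\<Sum>w | w \<in> insert c W \<and> R u w. e w) = e c + (\<Sum>w | w \<in> W \<and> R u w. e w)"
        using nb(2) fin grow.hyps(2-4) by simp
      moreover have "\<gamma>' u * e u = \<gamma> u * e u + e c"
        using e[of u] by (simp add: \<gamma>'_def field_simps)
      ultimately show ?thesis using True by (simp add: algebra_simps)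
    next
      case False
      then show ?thesis using grow.prems(2)[of x] x nb(3)[of x] by (simp add: \<gamma>'_def)
    qed
  qed
  define T where "T y x = int_nth (inverse (1 - fps_X) * (1 - fps_X) ^ card {w \<in> insert c W. R x w} * H x (y x))
    (charge R b k (insert c W) y x)" for y x
  define T' where "T' y x = int_nth (inverse (1 - fps_X) * (1 - fps_X) ^ card {w \<in> W. R x w} * H' x (y x))
    (charge R b k W y x)" for y x
  \<comment> \<open>Only the charge at \<open>u\<close> limits \<open>z\<close>. Pairs that make the
    charge at \<open>c\<close> negative are included, but they contribute 0 because
    \<open>int_nth\<close> vanishes at negative arguments.\<close>
  define S where "S = Sigma (admissible R b k v W) (\<lambda>y. {..nat (charge R b k W y u)})"
  define j where "j = (\<lambda>(y :: 'v \<Rightarrow> nat, z :: nat). y(c := z))"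
  have charge_c: "charge R b k (insert c W) (y(c := z)) c = k c + b c * int z - int (y u)" for y z
    using nb(1) uc by (simp add: charge_def)
  have charge_W: "charge R b k (insert c W) (y(c := z)) x = charge R b k W y x - (if x = u then int z else 0)"
    if x: "x \<in> W" for y z x
  proof -
    have *: "(\<Sum>w | w \<in> W \<and> R x w. int ((y(c := z)) w)) = (\<Sum>w | w \<in> W \<and> R x w. int (y w))"
      by (rule sum.cong) (use grow.hyps(2-4) in auto)
    show ?thesis
    proof (cases "x = u")
      case True
      have "(\<Sum>w | w \<in> insert c W \<and> R u w. int ((y(c := z)) w))
         = int z + (\<Sum>w | w \<in> W \<and> R u w. int ((y(c := z)) w))"
        using nb(2) fin grow.hyps(2-4) by simp
      then show ?thesis using True * uc by (simp add: charge_def)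
    next
      case False
      then show ?thesis using nb(3)[OF x False] * x grow.hyps(2) by (auto simp: charge_def)
    qed
  qed
  have inj: "inj_on j S"
  proof (rule inj_onI, clarify)
    fix y z y' z' assume a: "(y, z) \<in> S" "(y', z') \<in> S" "j (y, z) = j (y', z')"
    from a(3) have eq: "y(c := z) = y'(c := z')" by (simp add: j_def)
    from fun_cong[OF this, of c] have "z = z'" by simp
    moreover have "y x = y' x" for x
    proof (cases "x = c")
      case True
      then show ?thesis using a grow.hyps(2)
        by (auto simp: S_def admissible_def PiE_iff extensional_def)
    next
      case False
      then show ?thesis using fun_cong[OF eq, of x] by simp
    qed
    ultimately show "y = y' \<and> z = z'" by auto
  qed
  have sub: "admissible R b k v (insert c W) \<subseteq> j ` S"
  proof
    fix y assume y: "y \<in> admissible R b k v (insert c W)"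
    define y' where "y' = restrict y W"
    have yeq: "y = y'(c := y c)"
      using y by (auto simp: y'_def admissible_def PiE_iff extensional_def fun_eq_iff)
    have ch: "0 \<le> charge R b k W y' x - (if x = u then int (y c) else 0)" if "x \<in> W" for x
    proof -
      have "0 \<le> charge R b k (insert c W) y x" using y that by (auto simp: admissible_def)
      then show ?thesis using charge_W[OF that, of y' "y c"] yeq by simp
    qed
    have "y' \<in> admissible R b k v W"
      unfolding admissible_def
    proof (intro CollectI conjI ballI)
      show "y' \<in> W \<rightarrow>\<^sub>E UNIV" "y' v = 0" using y v by (auto simp: admissible_def y'_def)
      fix x assume "x \<in> W"
      from ch[OF this] show "0 \<le> charge R b k W y' x" by (auto split: if_splits)
    qed
    moreover have "y c \<le> nat (charge R b k W y' u)"
      using ch[OF grow.hyps(3)] by simp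
    ultimately have "(y', y c) \<in> S" by (simp add: S_def)
    then show "y \<in> j ` S" using yeq by (auto simp: j_def image_iff intro!: bexI[of _ "(y', y c)"])
  qed
  have finS: "finite S" using IH by (auto simp: S_def)
  have zero: "(\<Prod>x\<in>insert c W. T y x) = 0" if yj: "y \<in> j ` S - admissible R b k v (insert c W)" for y
  proof -
    obtain y' z where y': "y = y'(c := z)" "y' \<in> admissible R b k v W" "z \<le> nat (charge R b k W y' u)"
      using yj by (auto simp: S_def j_def simp del: fun_upd_apply)
    have "y \<in> insert c W \<rightarrow>\<^sub>E UNIV" "y v = 0"
      using y' cv by (auto simp: admissible_def PiE_iff extensional_def)
    then obtain x where x: "x \<in> insert c W" "charge R b k (insert c W) y x < 0"
      using yj by (fastforce simp: admissible_def not_le)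
    then have "T y x = 0" by (simp add: T_def int_nth_def)
    then show ?thesis using x(1) fin by (auto intro!: prod_zero)
  qed
  have inner: "(\<Sum>z\<le>nat (charge R b k W y u). \<Prod>x\<in>insert c W. T (y(c := z)) x) = (\<Prod>x\<in>W. T' y x)"
    if y: "y \<in> admissible R b k v W" for y
  proof -
    let ?r = "charge R b k W y u"
    have r: "0 \<le> ?r" using y grow.hyps(2-4) by (auto simp: admissible_def)
    let ?A = "(1 - fps_X) ^ card {w \<in> W. R u w} :: real fps"
    let ?B = "inverse (1 - fps_X) * ((1 - fps_X) * ?A) * H u (y u)"
    have Tc: "T (y(c := z)) c = fps_nth (F (y u)) z" for z
      using nb(1) by (simp add: T_def F_def charge_c inverse_one_minus_X_cancel)
    have Tu: "T (y(c := z)) u = int_nth ?B (?r - int z)" for z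
    proof -
      have "card {w \<in> insert c W. R u w} = Suc (card {w \<in> W. R u w})"
        using nb(2) fin grow.hyps(2-4) by simp
      then show ?thesis using charge_W[OF grow.hyps(3), of y z] uc by (simp add: T_def)
    qed
    have Tx: "T (y(c := z)) x = T' y x" if "x \<in> W - {u}" for x z
      using nb(3)[of x] charge_W[of x y z] that grow.hyps(2)
      by (auto simp: T_def T'_def H'_def)
    have "(\<Prod>x\<in>insert c W. T (y(c := z)) x)
        = fps_nth (F (y u)) z * int_nth ?B (?r - int z) * (\<Prod>x\<in>W - {u}. T' y x)" for z
    proof -
      have "(\<Prod>x\<in>insert c W. T (y(c := z)) x)
        = T (y(c := z)) c * (T (y(c := z)) u * (\<Prod>x\<in>W - {u}. T (y(c := z)) x))"
        using fin grow.hyps(2-4) by (simp add: prod.remove)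
      then show ?thesis using Tc Tu Tx by simp
    qed
    then have "(\<Sum>z\<le>nat ?r. \<Prod>x\<in>insert c W. T (y(c := z)) x)
        = int_nth (F (y u) * ?B) ?r * (\<Prod>x\<in>W - {u}. T' y x)"
      by (simp add: sum_distrib_right[symmetric] int_nth_mult[OF r])
    also have "F (y u) * ?B = inverse (1 - fps_X) * ?A * H' u (y u)"
      by (simp add: H'_def algebra_simps)
    also have "int_nth (inverse (1 - fps_X) * ?A * H' u (y u)) ?r = T' y u"
      by (simp add: T'_def)
    also have "T' y u * (\<Prod>x\<in>W - {u}. T' y x) = (\<Prod>x\<in>W. T' y x)"
      using fin grow.hyps(3) by (simp add: prod.remove)
    finally show ?thesis .
  qed
  have "(\<Sum>y\<in>admissible R b k v (insert c W). \<Prod>x\<in>insert c W. T y x)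
      = (\<Sum>y\<in>j ` S. \<Prod>x\<in>insert c W. T y x)"
    by (rule sum.mono_neutral_left) (use sub finS zero in auto)
  also have "\<dots> = (\<Sum>(y, z)\<in>S. \<Prod>x\<in>insert c W. T (y(c := z)) x)"
    by (subst sum.reindex[OF inj]) (simp add: j_def case_prod_unfold comp_def)
  also have "\<dots> = (\<Sum>y\<in>admissible R b k v W. \<Sum>z\<le>nat (charge R b k W y u). \<Prod>x\<in>insert c W. T (y(c := z)) x)"
    unfolding S_def by (rule sum.Sigma[symmetric]) (use IH in auto)
  also have "\<dots> = (\<Sum>y\<in>admissible R b k v W. \<Prod>x\<in>W. T' y x)"
    by (rule sum.cong) (use inner in auto)
  also have "\<dots> = of_int (k v) + 1" using IH by (simp add: T'_def)
  finally show ?case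
    using finite_subset[OF sub] finS by (simp add: T_def)
qed

section \<open>The lattice of a unimodular tree\<close>

lemma form_add_left: "form G (x + y) z = form G x z + form G y z"
  and form_diff_left: "form G (x - y) z = form G x z - form G y z"
  and form_scale_left: "form G (c *\<^sub>R x) z = c * form G x z"
  and form_add_right: "form G z (x + y) = form G z x + form G z y"
  and form_scale_right: "form G z (c *\<^sub>R x) = c * form G z x"
  by (simp_all add: form_def inner_add_left inner_diff_left inner_add_right matrix_vector_right_distrib
      matrix_vector_mult_scaleR)

lemma form_zero_left [simp]: "form G 0 z = 0"
  by (simp add: form_def)

lemma form_zero_right [simp]: "form G z 0 = 0"
  by (simp add: form_def)

lemma form_sum_left: "form G (\<Sum>i\<in>A. f i) z = (\<Sum>i\<in>A. form G (f i) z)"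
  by (induction A rule: infinite_finite_induct) (auto simp: form_add_left)

lemma form_sum_right: "form G z (\<Sum>i\<in>A. f i) = (\<Sum>i\<in>A. form G z (f i))"
  by (induction A rule: infinite_finite_induct) (auto simp: form_add_right)

lemma vec_eq_sum_E: "x = (\<Sum>v\<in>UNIV. x $ v *\<^sub>R E v)" for x :: "real ^ 'v::finite"
  using basis_expansion[of x] by (simp add: E_def scalar_mult_eq_scaleR)

lemma E_nth: "E v $ u = (if u = v then 1 else 0)"
  by (simp add: E_def axis_def)

lemma form_expand: "form G x y = (\<Sum>v\<in>UNIV. y $ v * form G x (E v))"
  by (subst vec_eq_sum_E[of y]) (simp only: form_sum_right form_scale_right)

lemma lattice_add: "x \<in> lattice \<Longrightarrow> y \<in> lattice \<Longrightarrow> x + y \<in> lattice"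
  and lattice_diff: "x \<in> lattice \<Longrightarrow> y \<in> lattice \<Longrightarrow> x - y \<in> lattice"
  and lattice_scale: "x \<in> lattice \<Longrightarrow> c \<in> \<int> \<Longrightarrow> c *\<^sub>R x \<in> lattice"
  and lattice_zero: "0 \<in> lattice"
  by (auto simp: lattice_def)

lemma lattice_sum: "(\<And>i. i \<in> A \<Longrightarrow> f i \<in> lattice) \<Longrightarrow> (\<Sum>i\<in>A. f i) \<in> lattice"
  by (induction A rule: infinite_finite_induct) (auto simp: lattice_zero intro: lattice_add)

lemma det_Ints:
  fixes A :: "real ^ 'n::finite ^ 'n"
  assumes "\<And>i j. A $ i $ j \<in> \<int>"
  shows "det A \<in> \<int>"
  unfolding det_def by (intro Ints_sum Ints_mult Ints_prod) (use assms in auto)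

text \<open>For a unimodular tree these are the coordinates of \<open>x\<close> in the basis of the
  vectors \<open>Estar G u\<close>; the Lipman cone is their positive orthant.\<close>

definition charge_of :: "'v::finite plumbing_graph \<Rightarrow> real ^ 'v \<Rightarrow> 'v \<Rightarrow> real" where
  "charge_of G x u = - form G x (E u)"

text \<open>The Riemann-Roch expression. Adjunction gives it the value 1 at each \<open>E v\<close>,
  which is the constant term in the increment of \<open>chi_add_E\<close>.\<close>

definition chi :: "'v::finite plumbing_graph \<Rightarrow> real ^ 'v \<Rightarrow> real" where
  "chi G l = - (form G l l + form G (canonical_class G) l) / 2"

definition vec_of :: "('v \<Rightarrow> nat) \<Rightarrow> real ^ 'v::finite" where
  "vec_of y = (\<chi> u. real (y u))"

definition exponent :: "'v::finite plumbing_graph \<Rightarrow> ('v \<Rightarrow> nat) \<Rightarrow> real ^ 'v" where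
  "exponent G \<kappa> = (\<Sum>v\<in>UNIV. real (\<kappa> v) *\<^sub>R Estar G v)"

text \<open>Allowing an arbitrary series at each vertex makes the counting function of
  \<open>Z\<close> and the Ehrhart count two instances of one notion, related by changing one factor
  at a time.\<close>

definition series_count :: "'v::finite plumbing_graph \<Rightarrow> ('v \<Rightarrow> real fps) \<Rightarrow> real ^ 'v \<Rightarrow> real" where
  "series_count G f l = (\<Sum>\<kappa> | \<not> l \<le> exponent G \<kappa>. \<Prod>v\<in>UNIV. fps_nth (f v) (\<kappa> v))"

definition vertex_series :: "'v plumbing_graph \<Rightarrow> 'v \<Rightarrow> real fps" where
  "vertex_series G v = (1 - fps_X) powi (int (valency G v) - 2)"

text \<open>The shape used in \<open>tree_sum\<close>: one factor \<open>1 - X\<close> per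
  neighbour, one factor \<open>1 / (1 - X)\<close>, and a series \<open>H\<close> that starts out as
  \<open>1 / (1 - X)\<close>, with no defect.\<close>

lemma vertex_series_eq:
  "vertex_series G v = inverse (1 - fps_X) * (1 - fps_X) ^ valency G v * inverse (1 - fps_X)"
proof -
  let ?X = "1 - fps_X :: real fps"
  have cancel: "?X * (inverse ?X * a) = a" "inverse ?X * (?X * a) = a" for a
    using inverse_one_minus_X_cancel by (metis mult.assoc mult.commute mult_1)+
  consider "valency G v = 0" | "valency G v = 1" | n where "valency G v = n + 2"
    by (metis Suc_1 add.commute add_2_eq_Suc less_2_cases_iff not_less le_Suc_ex One_nat_def)
  then show ?thesis
  proof cases
    case 1
    then show ?thesis
      by (simp add: vertex_series_def power_int_def power2_eq_square)
  next
    case 2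
    then show ?thesis by (simp add: vertex_series_def power_int_def cancel mult.assoc)
  next
    case (3 n)
    then have "vertex_series G v = ?X ^ n" by (simp add: vertex_series_def power_int_def)
    moreover have "inverse ?X * ?X ^ (n + 2) * inverse ?X = ?X ^ n"
      by (simp add: power_add power2_eq_square cancel ac_simps)
    ultimately show ?thesis using 3 by simp
  qed
qed

section \<open>Dual vectors, their positivity, and the increments of the counting function\<close>

locale unimodular_tree =
  fixes G :: "'v::finite plumbing_graph"
  assumes tree: "is_tree G" and neg_def: "negative_definite G"
    and unimodular: "det (- intersection_matrix G) = 1"
begin

lemma adj_sym: "adj G u v = adj G v u"
  using tree by (auto simp: is_tree_def dest: sympD)

lemma adj_irrefl: "\<not> adj G u u"
  using tree by (auto simp: is_tree_def dest: irreflpD)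

lemma adj_connected: "(adj G)\<^sup>*\<^sup>* u v"
  using tree by (auto simp: is_tree_def)

abbreviation M :: "real ^ 'v ^ 'v" where "M \<equiv> intersection_matrix G"

lemma M_sym: "transpose M = M"
  by (auto simp: intersection_matrix_def transpose_def vec_eq_iff adj_sym)

lemma form_sym: "form G x y = form G y x"
proof -
  have "x \<bullet> (M *v y) = (transpose M *v x) \<bullet> y" by (simp only: dot_lmul_matrix transpose_matrix_vector)
  then show ?thesis by (simp add: form_def M_sym inner_commute)
qed

lemma form_E_nth: "form G x (E u) = (M *v x) $ u"
  by (subst form_sym) (simp add: form_def E_def inner_axis')

lemma charge_of_eq: "charge_of G x u = - of_int (decoration G u) * x $ u - (\<Sum>w | adj G u w. x $ w)"
proof -
  have "(M *v x) $ u = (\<Sum>w\<in>UNIV. M $ u $ w * x $ w)"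
    by (simp add: matrix_vector_mult_def)
  also have "\<dots> = (\<Sum>w\<in>UNIV. (if w = u then of_int (decoration G u) * x $ w else 0) + (if adj G u w then x $ w else 0))"
    by (rule sum.cong) (auto simp: intersection_matrix_def adj_irrefl)
  also have "\<dots> = of_int (decoration G u) * x $ u + (\<Sum>w | adj G u w. x $ w)"
    by (simp add: sum.distrib sum.inter_filter[symmetric])
  finally show ?thesis by (simp add: charge_of_def form_E_nth)
qed

lemma charge_of_add: "charge_of G (x + y) u = charge_of G x u + charge_of G y u"
  and charge_of_diff: "charge_of G (x - y) u = charge_of G x u - charge_of G y u"
  and charge_of_scale: "charge_of G (c *\<^sub>R x) u = c * charge_of G x u"
  by (simp_all add: charge_of_def form_add_left form_diff_left form_scale_left)

lemma charge_of_sum: "charge_of G (\<Sum>i\<in>A. f i) u = (\<Sum>i\<in>A. charge_of G (f i) u)"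
  by (simp add: charge_of_def form_sum_left sum_negf)

lemma charge_of_Ints: "x \<in> lattice \<Longrightarrow> charge_of G x u \<in> \<int>"
  by (auto simp: charge_of_eq lattice_def)

lemma eq_if_charges_eq:
  assumes "\<And>u. charge_of G x u = charge_of G y u"
  shows "x = y"
proof (rule ccontr)
  assume "x \<noteq> y"
  then have "form G (x - y) (x - y) < 0" using neg_def by (simp add: negative_definite_def)
  moreover have "form G (x - y) (x - y) = 0"
    by (subst form_expand) (use assms in \<open>simp add: form_diff_left charge_of_def\<close>)
  ultimately show False by simp
qed

text \<open>By Cramer's rule with determinant 1, the coordinates of the solution are determinants of
  integer matrices.\<close>

lemma Estar_exists: "\<exists>x\<in>lattice. \<forall>w. form G x (E w) = (if v = w then -1 else 0)"
proof -
  define x :: "real ^ 'v" where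
    "x = (\<chi> k. det (\<chi> i j. if j = k then axis v 1 $ i else (- M) $ i $ j) / det (- M))"
  have "(- M) *v x = axis v 1"
    using cramer[of "- M" x "axis v 1"] unimodular unfolding x_def by simp
  then have eq: "M *v x = - axis v 1"
    by (simp add: vec_eq_iff matrix_vector_mult_def sum_negf) (metis minus_equation_iff)
  have "form G x (E w) = (if v = w then -1 else 0)" for w
    by (simp add: form_E_nth eq axis_def)
  moreover have "x \<in> lattice"
    unfolding lattice_def x_def unimodular
    by (auto intro!: det_Ints simp: axis_def intersection_matrix_def)
  ultimately show ?thesis by blast
qed

lemma Estar_lattice: "Estar G v \<in> lattice"
  and form_Estar_E: "form G (Estar G v) (E w) = (if v = w then -1 else 0)"
proof -
  obtain x where x: "x \<in> lattice" "\<forall>w. form G x (E w) = (if v = w then -1 else 0)"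
    using Estar_exists by blast
  have "Estar G v = x"
    unfolding Estar_def
  proof (rule the_equality)
    fix y assume "\<forall>w. form G y (E w) = (if v = w then -1 else 0)"
    then show "y = x" using x by (intro eq_if_charges_eq) (simp add: charge_of_def)
  qed (use x in blast)
  then show "Estar G v \<in> lattice" "form G (Estar G v) (E w) = (if v = w then -1 else 0)"
    using x by auto
qed

lemma charge_of_Estar: "charge_of G (Estar G v) w = (if w = v then 1 else 0)"
  by (simp add: charge_of_def form_Estar_E)

lemma form_eq_sum: "form G x y = - (\<Sum>v\<in>UNIV. charge_of G x v * y $ v)"
  by (subst form_expand) (simp add: charge_of_def sum_negf mult.commute)

text \<open>Let \<open>x = p - m\<close> be the decomposition into positive and negative part. The
  supports are disjoint, so \<open>(p, m)\<close> involves only off-diagonal entries and is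
  nonnegative, while \<open>(x, m) \<le> 0\<close> by the assumption. Hence
  \<open>(m, m) \<ge> 0\<close>, which forces \<open>m = 0\<close>.\<close>

lemma nonneg_if_charges_nonneg:
  assumes "\<And>u. 0 \<le> charge_of G x u"
  shows "0 \<le> x $ u"
proof (rule ccontr)
  assume neg: "\<not> 0 \<le> x $ u"
  define p where "p = (\<chi> w. max 0 (x $ w))"
  define m where "m = (\<chi> w. max 0 (- x $ w))"
  have x: "x = p - m" by (auto simp: p_def m_def vec_eq_iff)
  have "m \<noteq> 0" using neg by (auto simp: m_def vec_eq_iff intro!: exI[of _ u])
  then have "form G m m < 0" using neg_def by (simp add: negative_definite_def)
  moreover have "form G x m \<le> 0"
    unfolding form_eq_sum using assms by (auto intro!: sum_nonneg mult_nonneg_nonneg simp: m_def)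
  moreover have "0 \<le> form G p m"
  proof -
    have "- charge_of G p w * m $ w \<ge> 0" for w
    proof (cases "x $ w \<ge> 0")
      case False
      then have "p $ w = 0" by (simp add: p_def)
      then have "- charge_of G p w = (\<Sum>z | adj G w z. p $ z)" by (simp add: charge_of_eq)
      also have "\<dots> \<ge> 0" by (rule sum_nonneg) (simp add: p_def)
      finally have "charge_of G p w * m $ w \<le> 0"
        by (intro mult_nonpos_nonneg) (auto simp: m_def)
      then show ?thesis by simp
    qed (simp add: m_def)
    then show ?thesis unfolding form_eq_sum by (auto simp: sum_negf[symmetric] intro!: sum_nonneg)
  qed
  ultimately show False using x by (simp add: form_diff_left)
qed

text \<open>At a vanishing coordinate the charge is minus the sum of the neighbouring coordinates;
  as it is nonnegative, these vanish too, and connectedness spreads this to the whole vector. So all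
  coordinates are positive integers.\<close>

lemma Estar_ge_1: "1 \<le> Estar G v $ u"
proof -
  have nonneg: "0 \<le> Estar G v $ u" for u
    by (rule nonneg_if_charges_nonneg) (simp add: charge_of_Estar)
  have "Estar G v $ u \<noteq> 0"
  proof
    assume "Estar G v $ u = 0"
    have "Estar G v $ w = 0" for w
      using adj_connected[of u w]
    proof (induction rule: rtranclp_induct)
      case base
      then show ?case by fact
    next
      case (step y z)
      have "0 \<le> charge_of G (Estar G v) y" by (simp add: charge_of_Estar)
      then have "(\<Sum>w | adj G y w. Estar G v $ w) \<le> 0"
        using step by (simp add: charge_of_eq)
      then have "\<forall>w\<in>{w. adj G y w}. Estar G v $ w = 0"
        using nonneg by (subst sum_nonneg_eq_0_iff[symmetric]) (auto intro!: antisym sum_nonneg)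
      then show ?case using step by simp
    qed
    then have "Estar G v = 0" by (simp add: vec_eq_iff)
    then show False using charge_of_Estar[of v v] by (simp add: charge_of_def)
  qed
  then have "0 < Estar G v $ u" using nonneg[of u] by simp
  moreover have "Estar G v $ u \<in> \<int>" using Estar_lattice by (simp add: lattice_def)
  ultimately show ?thesis by (auto elim!: Ints_cases)
qed

lemma form_canonical_E: "form G (canonical_class G) (E v) = - of_int (decoration G v) - 2"
proof -
  have EE: "form G (E v) (E v) = of_int (decoration G v)" for v
    using charge_of_eq[of "E v" v] by (simp add: charge_of_def E_nth adj_irrefl)
  define k where "k = (\<Sum>v\<in>UNIV. (of_int (decoration G v) + 2) *\<^sub>R Estar G v)"
  have k: "form G k (E v) = - of_int (decoration G v) - 2" for v
    by (simp add: k_def form_sum_left form_scale_left form_Estar_E if_distrib cong: if_cong)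
  have "canonical_class G = k"
    unfolding canonical_class_def
  proof (rule the_equality)
    show "\<forall>v. form G (k + E v) (E v) + 2 = 0"
      by (simp add: form_add_left k EE)
    fix k' assume k': "\<forall>v. form G (k' + E v) (E v) + 2 = 0"
    then show "k' = k"
      by (intro eq_if_charges_eq) (simp add: form_add_left k EE charge_of_def, smt (verit))
  qed
  then show ?thesis using k by simp
qed

lemma chi_add: "chi G (x + y) = chi G x + chi G y - form G x y"
  by (simp add: chi_def form_add_left form_add_right form_sym[of y x] field_simps)

lemma chi_add_E: "chi G (l + E v) = chi G l + 1 + charge_of G l v"
proof -
  have "form G (E v) (E v) = of_int (decoration G v)"
    using charge_of_eq[of "E v" v] by (simp add: charge_of_def E_nth adj_irrefl)
  then have "chi G (E v) = 1" by (simp add: chi_def form_canonical_E)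
  then show ?thesis by (simp add: chi_add charge_of_def)
qed

lemma charge_of_exponent: "charge_of G (exponent G \<kappa>) u = real (\<kappa> u)"
  by (simp add: exponent_def charge_of_sum charge_of_scale charge_of_Estar if_distrib cong: if_cong)

lemma exponent_lattice: "exponent G \<kappa> \<in> lattice"
  unfolding exponent_def by (intro lattice_sum lattice_scale Estar_lattice) auto

lemma inj_exponent: "inj (exponent G)"
proof (rule injI)
  fix \<kappa> \<kappa>' assume "exponent G \<kappa> = exponent G \<kappa>'"
  then have "real (\<kappa> u) = real (\<kappa>' u)" for u
    using charge_of_exponent[of \<kappa> u] charge_of_exponent[of \<kappa>' u] by simp
  then show "\<kappa> = \<kappa>'" by auto
qed

text \<open>All coordinates of the dual vectors are at least 1. This is what makes every counting
  sum finite.\<close>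

lemma le_exponent: "real (\<kappa> v) \<le> exponent G \<kappa> $ u"
proof -
  have "real (\<kappa> v) * 1 \<le> real (\<kappa> v) * Estar G v $ u"
    by (intro mult_left_mono Estar_ge_1) auto
  also have "\<dots> \<le> (\<Sum>w\<in>UNIV. real (\<kappa> w) * Estar G w $ u)"
    by (rule member_le_sum) (auto intro!: mult_nonneg_nonneg order_trans[OF zero_le_one Estar_ge_1])
  also have "\<dots> = exponent G \<kappa> $ u" by (simp add: exponent_def)
  finally show ?thesis by simp
qed

lemma finite_not_le_exponent: "finite {\<kappa>. \<not> l \<le> exponent G \<kappa>}"
proof -
  define B where "B = nat \<lceil>\<Sum>u\<in>UNIV. \<bar>l $ u\<bar>\<rceil>"
  have "{\<kappa>. \<not> l \<le> exponent G \<kappa>} \<subseteq> {\<kappa>. \<forall>v. \<kappa> v \<in> {..B}}"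
  proof (intro subsetI CollectI allI)
    fix \<kappa> v assume "\<kappa> \<in> {\<kappa>. \<not> l \<le> exponent G \<kappa>}"
    then obtain u where "exponent G \<kappa> $ u < l $ u" by (auto simp: less_eq_vec_def not_le)
    then have "real (\<kappa> v) < \<bar>l $ u\<bar>" using le_exponent[of \<kappa> v u] by linarith
    also have "\<dots> \<le> (\<Sum>u\<in>UNIV. \<bar>l $ u\<bar>)" by (rule member_le_sum) auto
    finally show "\<kappa> v \<in> {..B}" unfolding B_def atMost_iff by linarith
  qed
  moreover have "finite {\<kappa>::'v \<Rightarrow> nat. \<forall>v. \<kappa> v \<in> {..B}}"
    using finite_PiE[of "UNIV :: 'v set" "\<lambda>_. {..B}"] by (simp add: PiE_def Pi_def extensional_def)
  ultimately show ?thesis by (rule finite_subset)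
qed

lemma Z_coeff_exponent: "Z_coeff G (exponent G \<kappa>) = (\<Prod>v\<in>UNIV. fps_nth (vertex_series G v) (\<kappa> v))"
proof -
  have "{k. (\<Sum>v\<in>UNIV. real (k v) *\<^sub>R Estar G v) = exponent G \<kappa>} = {\<kappa>}"
    using inj_exponent unfolding exponent_def[symmetric] by (auto simp: inj_def)
  then show ?thesis by (simp add: Z_coeff_def vertex_series_def)
qed

lemma Z_coeff_nonzeroD: "Z_coeff G l \<noteq> 0 \<Longrightarrow> l \<in> range (exponent G)"
  by (rule ccontr) (auto simp: Z_coeff_def exponent_def image_iff, metis (mono_tags, lifting) empty_Collect_eq sum.empty)

lemma counting_function_Z: "counting_function (Z_coeff G) l = series_count G (vertex_series G) l"
proof -
  have "counting_function (Z_coeff G) l = (\<Sum>x\<in>exponent G ` {\<kappa>. \<not> l \<le> exponent G \<kappa>}. Z_coeff G x)"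
    unfolding counting_function_def
  proof (rule sum.mono_neutral_left)
    show "finite (exponent G ` {\<kappa>. \<not> l \<le> exponent G \<kappa>})" using finite_not_le_exponent by blast
  qed (use Z_coeff_nonzeroD in \<open>fastforce simp: image_iff\<close>)+
  also have "\<dots> = series_count G (vertex_series G) l"
    by (subst sum.reindex) (auto intro: inj_on_subset[OF inj_exponent] simp: series_count_def Z_coeff_exponent)
  finally show ?thesis .
qed

definition deep :: "real \<Rightarrow> real ^ 'v \<Rightarrow> bool" where
  "deep N l \<longleftrightarrow> l \<in> lattice \<and> (\<forall>u. N \<le> charge_of G l u)"

lemma series_count_add_E:
  assumes N: "\<And>u w. Estar G v $ u \<le> N" and l: "deep N l"
  shows "series_count G (vertex_series G) (l + E v) = series_count G (vertex_series G) l + 1 + charge_of G l v"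
proof -
  define k where "k u = \<lfloor>charge_of G l u\<rfloor>" for u
  define b where "b u = - decoration G u" for u
  let ?e = "\<lambda>u. Estar G v $ u"
  let ?Y = "admissible (adj G) b k v UNIV"
  let ?c = "charge (adj G) b k UNIV"
  have k: "of_int (k u) = charge_of G l u" for u
    using l charge_of_Ints[of l u] by (auto simp: deep_def k_def elim!: Ints_cases)
  have N1: "1 \<le> N" using N[of v] Estar_ge_1[of v v] by simp
  have kN: "N \<le> of_int (k u)" for u using l by (simp add: k deep_def)
  have "finite ?Y \<and>
    (\<Sum>y\<in>?Y. \<Prod>u\<in>UNIV. int_nth (inverse (1 - fps_X) * (1 - fps_X) ^ card {w \<in> UNIV. adj G u w} * inverse (1 - fps_X)) (?c y u))
    = of_int (k v) + 1"
  \<comment> \<open>The charges of \<open>Estar G v\<close> vanish off \<open>v\<close>, so the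
    inequality at the other vertices is an equality, with initial slopes 0. The coordinates of
    \<open>Estar G v\<close> lie between 1 and \<open>N\<close>, so charges of at least
    \<open>N\<close> satisfy the depth condition.\<close>
  proof (rule tree_sum[where e = ?e and \<gamma> = "\<lambda>_. 0" and H = "\<lambda>_ _. inverse (1 - fps_X)"])
    show "symp (adj G)" "irreflp (adj G)" using tree by (auto simp: is_tree_def)
    show "0 < ?e u" for u using Estar_ge_1[of v u] by simp
    show "0 \<le> k u" for u using kN[of u] N1 by linarith
    show "?e w \<le> of_int (k u) * ?e u" for u w
    proof -
      have "?e w * 1 \<le> of_int (k u) * ?e u"
        using N[of w] kN[of u] N1 Estar_ge_1[of v u] by (intro mult_mono) auto
      then show ?thesis by simp
    qed
    show "rooted_tree (adj G) v UNIV" using tree by (rule rooted_tree_UNIV)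
    show "\<exists>d. real d \<le> 0 * real y \<and> one_from (inverse (1 - fps_X)) d" for y
      by (intro exI[of _ 0]) (simp add: one_from_def fps_nth_inverse_one_minus_X)
    show "(\<Sum>w | w \<in> UNIV \<and> adj G u w. ?e w) \<le> (of_int (b u) - 0) * ?e u" if "u \<noteq> v" for u
      using charge_of_eq[of "Estar G v" u] that by (simp add: charge_of_Estar b_def)
  qed
  then have fin: "finite ?Y" and sum: "(\<Sum>y\<in>?Y. \<Prod>u\<in>UNIV. int_nth (vertex_series G u) (?c y u)) = charge_of G l v + 1"
    by (auto simp: vertex_series_eq valency_def k)
  have charge: "of_int (?c y u) = charge_of G (l + vec_of y) u" for y u
    by (simp add: charge_def charge_of_add k charge_of_eq vec_of_def b_def sum.distrib algebra_simps)
  define g where "g y u = nat (?c y u)" for y u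
  have exp_g: "exponent G (g y) = l + vec_of y" if "y \<in> ?Y" for y
  proof (rule eq_if_charges_eq)
    fix u
    have "0 \<le> ?c y u" using that by (auto simp: admissible_def)
    then show "charge_of G (exponent G (g y)) u = charge_of G (l + vec_of y) u"
      by (simp add: charge_of_exponent g_def charge[symmetric])
  qed
  \<comment> \<open>The exponents counted by the increment. Each is \<open>l + y\<close> with
    \<open>y \<ge> 0\<close> and \<open>y v = 0\<close>, and its charges are the natural numbers
    \<open>\<kappa> u\<close>; this matches \<open>?D\<close> with the admissible families.\<close>
  let ?D = "{\<kappa>. l \<le> exponent G \<kappa> \<and> \<not> l + E v \<le> exponent G \<kappa>}"
  have inj: "inj_on g ?Y"
  proof (rule inj_onI)
    fix y y' assume "y \<in> ?Y" "y' \<in> ?Y" "g y = g y'"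
    then have "vec_of y = vec_of y'" using exp_g by (metis add_left_cancel)
    then show "y = y'" by (auto simp: vec_of_def vec_eq_iff)
  qed
  have img: "g ` ?Y = ?D"
  proof (intro equalityI subsetI)
    fix \<kappa> assume "\<kappa> \<in> g ` ?Y"
    then obtain y where y: "y \<in> ?Y" "\<kappa> = g y" by blast
    then have "(l + vec_of y) $ v < (l + E v) $ v"
      by (simp add: vec_of_def admissible_def E_nth)
    then have "\<not> l + E v \<le> l + vec_of y" unfolding less_eq_vec_def by (meson not_le)
    moreover have "l \<le> l + vec_of y" by (simp add: less_eq_vec_def vec_of_def)
    ultimately show "\<kappa> \<in> ?D" using y exp_g by simp
  next
    fix \<kappa> assume \<kappa>: "\<kappa> \<in> ?D"
    define y where "y u = nat \<lfloor>exponent G \<kappa> $ u - l $ u\<rfloor>" for u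
    have y: "real (y u) = exponent G \<kappa> $ u - l $ u" for u
    proof -
      have "exponent G \<kappa> $ u - l $ u \<in> \<int>" "0 \<le> exponent G \<kappa> $ u - l $ u"
        using exponent_lattice[of \<kappa>] l \<kappa> by (auto simp: lattice_def deep_def less_eq_vec_def)
      then show ?thesis by (auto simp: y_def elim!: Ints_cases)
    qed
    then have vec_y: "l + vec_of y = exponent G \<kappa>" by (simp add: vec_of_def vec_eq_iff)
    obtain u where u: "exponent G \<kappa> $ u < (l + E v) $ u"
      using \<kappa> by (auto simp: less_eq_vec_def not_le)
    have "l $ u \<le> exponent G \<kappa> $ u" using \<kappa> by (simp add: less_eq_vec_def)
    then have "u = v" using u by (auto simp: E_nth split: if_splits)
    then have "y v = 0" using u y[of v] by (simp add: E_nth)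
    have c: "?c y u = int (\<kappa> u)" for u
      using charge[of y u] unfolding vec_y charge_of_exponent by linarith
    have "y \<in> ?Y" using \<open>y v = 0\<close> by (auto simp: admissible_def c)
    moreover have "g y = \<kappa>" by (auto simp: g_def c)
    ultimately show "\<kappa> \<in> g ` ?Y" by blast
  qed
  have "series_count G (vertex_series G) (l + E v)
    = (\<Sum>\<kappa>\<in>{\<kappa>. \<not> l \<le> exponent G \<kappa>} \<union> ?D. \<Prod>u\<in>UNIV. fps_nth (vertex_series G u) (\<kappa> u))"
  proof -
    have "l \<le> l + E v" by (simp add: less_eq_vec_def E_nth)
    then have "{\<kappa>. \<not> l + E v \<le> exponent G \<kappa>} = {\<kappa>. \<not> l \<le> exponent G \<kappa>} \<union> ?D"
      using order_trans[of l "l + E v"] by blast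
    then show ?thesis by (simp add: series_count_def)
  qed
  also have "\<dots> = series_count G (vertex_series G) l + (\<Sum>\<kappa>\<in>?D. \<Prod>u\<in>UNIV. fps_nth (vertex_series G u) (\<kappa> u))"
    unfolding series_count_def
  proof (rule sum.union_disjoint[OF finite_not_le_exponent])
    show "finite ?D" using fin unfolding img[symmetric] by blast
  qed blast
  also have "(\<Sum>\<kappa>\<in>?D. \<Prod>u\<in>UNIV. fps_nth (vertex_series G u) (\<kappa> u))
      = (\<Sum>y\<in>?Y. \<Prod>u\<in>UNIV. fps_nth (vertex_series G u) (g y u))"
    unfolding img[symmetric] by (subst sum.reindex[OF inj]) simp
  also have "\<dots> = charge_of G l v + 1"
    unfolding sum[symmetric]
    by (intro sum.cong prod.cong) (auto simp: admissible_def g_def int_nth_def simp flip: not_le)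
  finally show ?thesis by simp
qed

end

section \<open>The counting function and its periodic constant\<close>

lemma finite_index_sublatticeD:
  assumes "finite_index_sublattice M L"
  shows "M \<subseteq> L" "0 \<in> M" "x \<in> M \<Longrightarrow> y \<in> M \<Longrightarrow> x - y \<in> M" "x \<in> M \<Longrightarrow> y \<in> M \<Longrightarrow> x + y \<in> M"
    "finite ((\<lambda>a. (+) a ` M) ` L)"
proof -
  show 1: "M \<subseteq> L" "0 \<in> M" "x \<in> M \<Longrightarrow> y \<in> M \<Longrightarrow> x - y \<in> M" "finite ((\<lambda>a. (+) a ` M) ` L)" for x y
    using assms by (auto simp: finite_index_sublattice_def)
  show "x + y \<in> M" if "x \<in> M" "y \<in> M"
    using 1(3)[OF that(1) 1(3)[OF 1(2) that(2)]] by simp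
qed

lemma finite_index_sublattice_scale:
  fixes M :: "'a::real_vector set"
  assumes "finite_index_sublattice M L" "z \<in> M"
  shows "real t *\<^sub>R z \<in> M"
  by (induction t)
    (auto simp: scaleR_left_distrib finite_index_sublatticeD[OF assms(1)] assms(2))

text \<open>By the pigeonhole principle two multiples of \<open>z\<close> lie in the same coset;
  their difference is the multiple sought.\<close>

lemma finite_index_sublattice_multiple:
  fixes M :: "'a::real_vector set"
  assumes M: "finite_index_sublattice M L" and z: "\<And>t::nat. real t *\<^sub>R z \<in> L"
  obtains d :: nat where "0 < d" "real d *\<^sub>R z \<in> M"
proof -
  let ?h = "\<lambda>t::nat. (+) (real t *\<^sub>R z) ` M"
  have "finite (range ?h)"
    by (rule finite_subset[OF _ finite_index_sublatticeD(5)[OF M]]) (use z in auto)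
  then have "\<not> inj ?h" using finite_imageD by blast
  then obtain i j where ij: "?h i = ?h j" "i < j"
    unfolding inj_def by (metis linorder_neqE_nat)
  have "real j *\<^sub>R z \<in> ?h j"
    using finite_index_sublatticeD(2)[OF M] by (auto intro!: image_eqI[of _ _ 0])
  then obtain x where x: "x \<in> M" "real j *\<^sub>R z = real i *\<^sub>R z + x"
    unfolding ij(1)[symmetric] by auto
  have "real (j - i) *\<^sub>R z = x"
    using x(2) ij(2) by (simp add: of_nat_diff scaleR_left_diff_distrib)
  then show ?thesis using that[of "j - i"] ij(2) x(1) by simp
qed

lemma real_polynomial_function_ray:
  assumes "real_polynomial_function P"
  shows "\<exists>p. \<forall>t. P (l + t *\<^sub>R z) = poly p t"
  using assms
proof (induction rule: real_polynomial_function.induct)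
  case (linear f)
  then interpret bounded_linear f .
  show ?case by (intro exI[of _ "[:f l, f z:]"]) (simp add: add scaleR)
next
  case (const c)
  then show ?case by (intro exI[of _ "[:c:]"]) simp
next
  case (add f g)
  then obtain p q where "\<forall>t. f (l + t *\<^sub>R z) = poly p t" "\<forall>t. g (l + t *\<^sub>R z) = poly q t" by blast
  then show ?case by (intro exI[of _ "p + q"]) simp
next
  case (mult f g)
  then obtain p q where "\<forall>t. f (l + t *\<^sub>R z) = poly p t" "\<forall>t. g (l + t *\<^sub>R z) = poly q t" by blast
  then show ?case by (intro exI[of _ "p * q"]) simp
qed

lemma poly_eq_if_eventually:
  assumes "\<forall>\<^sub>F t::nat in sequentially. poly p (real t) = poly q (real t)"
  shows "p = (q :: real poly)"
proof (rule ccontr)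
  assume "p \<noteq> q"
  then have "finite {x. poly (p - q) x = 0}" by (intro poly_roots_finite) simp
  moreover obtain T :: nat where "\<forall>t\<ge>T. poly p (real t) = poly q (real t)"
    using assms by (auto simp: eventually_sequentially)
  then have "real ` {T..} \<subseteq> {x. poly (p - q) x = 0}" by auto
  ultimately have "finite (real ` {T..})" by (rule finite_subset[rotated])
  then show False using infinite_Ici[of T] by (auto dest!: finite_imageD simp: inj_on_def)
qed

section \<open>Polynomiality and eventual equality along lattice rays\<close>

definition ray_poly :: "real ^ 'v::finite \<Rightarrow> (real ^ 'v \<Rightarrow> real) \<Rightarrow> bool" where
  "ray_poly z f \<longleftrightarrow> (\<forall>l\<in>lattice. \<exists>p. \<forall>t::nat. f (l + real t *\<^sub>R z) = poly p (real t))"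

text \<open>All lattice points are allowed as starting points, because a backward difference
  compares parallel rays; this makes the relation stable under differences.\<close>

definition eq_on_rays :: "real ^ 'v::finite \<Rightarrow> (real ^ 'v \<Rightarrow> real) \<Rightarrow> (real ^ 'v \<Rightarrow> real) \<Rightarrow> bool" where
  "eq_on_rays z f g \<longleftrightarrow>
     (\<forall>l\<in>lattice. \<forall>\<^sub>F t::nat in sequentially. f (l + real t *\<^sub>R z) = g (l + real t *\<^sub>R z))"

text \<open>Two polynomials that agree at all large integers are equal, and the starting point is
  the value \<open>t = 0\<close>. In this way an equality known deep in a cone spreads to the whole
  lattice.\<close>

lemma ray_poly_eqD:
  assumes "ray_poly z f" "ray_poly z g" "eq_on_rays z f g" "l \<in> lattice"
  shows "f l = g l"
proof -
  obtain p q where pq: "\<forall>t::nat. f (l + real t *\<^sub>R z) = poly p (real t)"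
    "\<forall>t::nat. g (l + real t *\<^sub>R z) = poly q (real t)"
    using assms(1,2,4) unfolding ray_poly_def by blast
  then have "p = q"
    using assms(3,4) by (intro poly_eq_if_eventually) (auto simp: eq_on_rays_def)
  then show ?thesis using pq[THEN spec, of 0] by simp
qed

lemma eq_on_rays_trans [trans]: "eq_on_rays z f g \<Longrightarrow> eq_on_rays z g h \<Longrightarrow> eq_on_rays z f h"
  unfolding eq_on_rays_def
proof
  fix l :: "real ^ 'a" assume *: "\<forall>l\<in>lattice. \<forall>\<^sub>F t::nat in sequentially. f (l + real t *\<^sub>R z) = g (l + real t *\<^sub>R z)"
    "\<forall>l\<in>lattice. \<forall>\<^sub>F t::nat in sequentially. g (l + real t *\<^sub>R z) = h (l + real t *\<^sub>R z)" "l \<in> lattice"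
  from *(1)[rule_format, OF *(3)] *(2)[rule_format, OF *(3)]
  show "\<forall>\<^sub>F t::nat in sequentially. f (l + real t *\<^sub>R z) = h (l + real t *\<^sub>R z)"
    by eventually_elim simp
qed

text \<open>A multiple of \<open>z\<close> in the period lattice keeps each ray inside one coset,
  where \<open>f\<close> is a single polynomial.\<close>

lemma quasipolynomial_ray_poly:
  assumes "quasipolynomial_on lattice f" and "z \<in> lattice"
  obtains d :: nat where "0 < d" "ray_poly (real d *\<^sub>R z) f"
proof -
  obtain M where M: "finite_index_sublattice M lattice"
    and P: "\<forall>a\<in>lattice. \<exists>P. real_polynomial_function P \<and> (\<forall>x\<in>M. f (a + x) = P (a + x))"
    using assms(1) by (auto simp: quasipolynomial_on_def)
  have "real t *\<^sub>R z \<in> lattice" for t :: nat using assms(2) by (intro lattice_scale) auto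
  then obtain d :: nat where d: "0 < d" "real d *\<^sub>R z \<in> M"
    using finite_index_sublattice_multiple[OF M] by blast
  have "ray_poly (real d *\<^sub>R z) f"
    unfolding ray_poly_def
  proof
    fix l :: "real ^ 'a" assume "l \<in> lattice"
    then obtain P where P: "real_polynomial_function P" "\<forall>x\<in>M. f (l + x) = P (l + x)" using P by blast
    obtain p where "\<forall>t. P (l + t *\<^sub>R (real d *\<^sub>R z)) = poly p t"
      using real_polynomial_function_ray[OF P(1)] by blast
    then show "\<exists>p. \<forall>t::nat. f (l + real t *\<^sub>R real d *\<^sub>R z) = poly p (real t)"
      using P(2) finite_index_sublattice_scale[OF M d(2)] by metis
  qed
  with d(1) show ?thesis by (rule that)
qed

section \<open>Iterated backward differences on rays\<close>

definition nab :: "'a::ab_group_add \<Rightarrow> ('a \<Rightarrow> real) \<Rightarrow> 'a \<Rightarrow> real" where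
  "nab w f = (\<lambda>x. f x - f (x - w))"

definition diffs :: "('v \<Rightarrow> 'a::ab_group_add) \<Rightarrow> ('v \<Rightarrow> nat) \<Rightarrow> 'v list \<Rightarrow> ('a \<Rightarrow> real) \<Rightarrow> 'a \<Rightarrow> real" where
  "diffs s m ns f = foldr (\<lambda>n. nab (s n) ^^ m n) ns f"

lemma diffs_Nil [simp]: "diffs s m [] f = f"
  and diffs_Cons [simp]: "diffs s m (n # ns) f = (nab (s n) ^^ m n) (diffs s m ns f)"
  by (simp_all add: diffs_def)

lemma nab_closed_imp_diffs:
  assumes "\<And>f n. n \<in> set ns \<Longrightarrow> P f \<Longrightarrow> P (nab (s n) f)" and "P f"
  shows "P (diffs s m ns f)"
  using assms(1)
proof (induction ns)
  case Nil
  then show ?case using assms(2) by simp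
next
  case (Cons n ns)
  have "P ((nab (s n) ^^ j) (diffs s m ns f))" for j
    by (induction j) (use Cons in auto)
  then show ?case by simp
qed

lemma ray_poly_nab:
  assumes "w \<in> lattice" "ray_poly z f"
  shows "ray_poly z (nab w f)"
  unfolding ray_poly_def
proof
  fix l :: "real ^ 'a" assume l: "l \<in> lattice"
  then obtain p q where "\<forall>t::nat. f (l + real t *\<^sub>R z) = poly p (real t)"
    "\<forall>t::nat. f (l - w + real t *\<^sub>R z) = poly q (real t)"
    using assms lattice_diff[OF l assms(1)] unfolding ray_poly_def by blast
  then show "\<exists>p. \<forall>t::nat. nab w f (l + real t *\<^sub>R z) = poly p (real t)"
    by (intro exI[of _ "p - q"]) (simp add: nab_def algebra_simps)
qed

lemma eq_on_rays_nab:
  assumes "w \<in> lattice" "eq_on_rays z f g"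
  shows "eq_on_rays z (nab w f) (nab w g)"
  unfolding eq_on_rays_def
proof
  fix l :: "real ^ 'a" assume l: "l \<in> lattice"
  have "\<forall>\<^sub>F t::nat in sequentially. f (l + real t *\<^sub>R z) = g (l + real t *\<^sub>R z)"
    "\<forall>\<^sub>F t::nat in sequentially. f (l - w + real t *\<^sub>R z) = g (l - w + real t *\<^sub>R z)"
    using assms lattice_diff[OF l assms(1)] l unfolding eq_on_rays_def by blast+
  then show "\<forall>\<^sub>F t::nat in sequentially. nab w f (l + real t *\<^sub>R z) = nab w g (l + real t *\<^sub>R z)"
    by eventually_elim (simp add: nab_def algebra_simps)
qed

lemma ray_poly_diffs:
  assumes "\<And>n. s n \<in> lattice" "ray_poly z f"
  shows "ray_poly z (diffs s m ns f)"
  by (rule nab_closed_imp_diffs) (use assms ray_poly_nab in auto)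

lemma eq_on_rays_diffs:
  assumes "\<And>n. s n \<in> lattice" "eq_on_rays z f g"
  shows "eq_on_rays z (diffs s m ns f) (diffs s m ns g)"
proof (induction ns)
  case (Cons n ns)
  have "eq_on_rays z ((nab (s n) ^^ j) (diffs s m ns f)) ((nab (s n) ^^ j) (diffs s m ns g))" for j
    by (induction j) (use Cons assms(1) in \<open>auto intro: eq_on_rays_nab\<close>)
  then show ?case by simp
qed (use assms(2) in simp)

lemma lattice_finite_index: "finite_index_sublattice lattice lattice"
proof -
  have "(+) a ` lattice = lattice" if "a \<in> lattice" for a :: "real ^ 'a"
  proof (intro equalityI subsetI)
    fix x assume "x \<in> (+) a ` lattice"
    then show "x \<in> lattice" using that by (auto intro: lattice_add)
  next
    fix x :: "real ^ 'a" assume "x \<in> lattice"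
    then have "x - a \<in> lattice" using that by (intro lattice_diff)
    then show "x \<in> (+) a ` lattice" by (intro image_eqI[of _ _ "x - a"]) auto
  qed
  then have "(\<lambda>a. (+) a ` lattice) ` lattice \<subseteq> {lattice :: (real ^ 'a) set}" by auto
  then show ?thesis
    unfolding finite_index_sublattice_def
    using finite_subset[OF _ finite.insertI[OF finite.emptyI]]
    by (auto simp: lattice_zero intro: lattice_diff)
qed

text \<open>Rounding \<open>n x\<close> down in each coordinate moves it by at most the dimension,
  which is less than \<open>n r\<close> for large \<open>n\<close>; dividing by \<open>n\<close>
  stays in the ball around \<open>x\<close>.\<close>

lemma lattice_ray_in_open:
  fixes U :: "(real ^ 'v::finite) set"
  assumes "open U" "U \<noteq> {}"
  obtains z c where "z \<in> lattice" "0 < c" "c *\<^sub>R z \<in> U"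
proof -
  obtain x r where x: "0 < r" "ball x r \<subseteq> U"
    using assms by (metis ex_in_conv openE)
  obtain n :: nat where n: "real CARD('v) / r < real n" using reals_Archimedean2 by blast
  have "0 < real n" using n x(1) by (meson divide_nonneg_pos le_less_trans of_nat_0_le_iff)
  define z :: "real ^ 'v" where "z = (\<chi> i. of_int \<lfloor>real n * x $ i\<rfloor>)"
  have "norm (real n *\<^sub>R x - z) \<le> (\<Sum>i\<in>UNIV. \<bar>(real n *\<^sub>R x - z) $ i\<bar>)" by (rule norm_le_l1_cart)
  also have "\<dots> \<le> (\<Sum>i\<in>(UNIV::'v set). 1)" by (rule sum_mono) (simp add: z_def, linarith)
  also have "\<dots> < real n * r" using n x(1) by (simp add: field_simps)
  finally have "norm (real n *\<^sub>R x - z) < real n * r" .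
  moreover have "real n *\<^sub>R x - z = real n *\<^sub>R (x - (1 / real n) *\<^sub>R z)"
    using \<open>0 < real n\<close> by (simp add: scaleR_right_diff_distrib)
  ultimately have "norm (x - (1 / real n) *\<^sub>R z) < r" using \<open>0 < real n\<close> by simp
  then have "(1 / real n) *\<^sub>R z \<in> U" using x(2) by (auto simp: dist_norm)
  moreover have "z \<in> lattice" by (simp add: z_def lattice_def)
  ultimately show ?thesis using that[of z "1 / real n"] \<open>0 < real n\<close> by simp
qed

text \<open>Scaled by \<open>c / t\<close>, the point becomes \<open>c z + (c / t) l\<close>, which
  tends to the interior point \<open>c z\<close>; scaling back stays in the cone.\<close>

lemma cone_ray_eventually:
  fixes z :: "'a::real_normed_vector"
  assumes cone: "\<And>x c. x \<in> A \<Longrightarrow> 0 \<le> c \<Longrightarrow> c *\<^sub>R x \<in> A" and z: "0 < c" "c *\<^sub>R z \<in> interior A"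
  shows "\<forall>\<^sub>F t::nat in sequentially. l + real t *\<^sub>R z \<in> A"
proof -
  obtain r where r: "0 < r" "ball (c *\<^sub>R z) r \<subseteq> A"
    using z(2) by (auto simp: mem_interior)
  have "\<forall>\<^sub>F t::nat in sequentially. max 1 (c * norm l / r) < real t"
    using filterlim_real_sequentially unfolding filterlim_at_top_dense by blast
  then show ?thesis
  proof eventually_elim
    case (elim t)
    then have t: "0 < real t" "c * norm l / real t < r" using r(1) by (auto simp: field_simps)
    then have "c *\<^sub>R z + (c / real t) *\<^sub>R l \<in> A"
      using r(2) z(1) by (intro subsetD[OF r(2)]) (simp add: dist_norm)
    from cone[OF this, of "real t / c"] show ?case
      using t z(1) by (simp add: scaleR_right_distrib add.commute)
  qed
qed

lemma nat_fun_finite_induct [consumes 0, case_names zero Suc]: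
  fixes P :: "('v::finite \<Rightarrow> nat) \<Rightarrow> bool"
  assumes "P (\<lambda>_. 0)" and "\<And>y v. P y \<Longrightarrow> P (y(v := Suc (y v)))"
  shows "P y"
proof (induction "\<Sum>v\<in>UNIV. y v" arbitrary: y)
  case 0
  then have "y = (\<lambda>_. 0)" by auto
  then show ?case using assms(1) by simp
next
  case (Suc n)
  then obtain v where v: "y v \<noteq> 0" by (metis sum.neutral nat.distinct(1))
  define y' where "y' = y(v := y v - 1)"
  have y: "y = y'(v := Suc (y' v))" using v by (auto simp: y'_def)
  have "(\<Sum>u\<in>UNIV. y u) = Suc (\<Sum>u\<in>UNIV. y' u)"
    by (subst (1 2) sum.remove[of _ v]) (use v in \<open>auto simp: y'_def\<close>)
  then have "P y'" using Suc by simp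
  then show ?case using assms(2) y by metis
qed

section \<open>The counting function deep in the Lipman cone\<close>

context unimodular_tree
begin

abbreviation \<rho> :: "real ^ 'v" where "\<rho> \<equiv> \<Sum>v\<in>UNIV. Estar G v"

lemma charge_of_rho: "charge_of G \<rho> u = 1"
  by (simp add: charge_of_sum charge_of_Estar)

lemma rho_lattice: "\<rho> \<in> lattice"
  by (intro lattice_sum Estar_lattice)

lemma lipman_cone_iff: "x \<in> lipman_cone G \<longleftrightarrow> (\<forall>u. 0 \<le> charge_of G x u)"
  by (simp add: lipman_cone_def charge_of_def)

lemma exponent_upd_Suc: "exponent G (\<kappa>(v := Suc (\<kappa> v))) = exponent G \<kappa> + Estar G v"
  by (rule eq_if_charges_eq) (simp add: charge_of_exponent charge_of_add charge_of_Estar)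

text \<open>A step by \<open>E v\<close> leaves \<open>Q - chi\<close> unchanged but lowers charges
  at the neighbours, so it may leave the deep region. A step by \<open>Estar G v\<close> only raises
  one charge. Each step of the second kind is therefore split into steps of the first kind with
  controlled loss, and the second kind leads from a multiple of \<open>\<rho>\<close> to every
  sufficiently deep lattice point.\<close>

lemma series_count_eventually_chi:
  obtains N c where "0 \<le> N" "\<And>l. deep N l \<Longrightarrow> series_count G (vertex_series G) l = chi G l + c"
proof -
  let ?Q = "series_count G (vertex_series G)"
  define f where "f l = ?Q l - chi G l" for l
  define S where "S = (\<Sum>v\<in>UNIV. \<Sum>u\<in>UNIV. Estar G v $ u)"
  have nonneg: "0 \<le> Estar G v $ u" for v u using Estar_ge_1[of v u] by simp
  have S: "Estar G v $ u \<le> S" for v u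
  proof -
    have "Estar G v $ u \<le> (\<Sum>u\<in>UNIV. Estar G v $ u)" by (rule member_le_sum) (use nonneg in auto)
    also have "\<dots> \<le> S" unfolding S_def by (rule member_le_sum) (auto intro: sum_nonneg nonneg)
    finally show ?thesis .
  qed
  \<comment> \<open>The largest loss of charge on the way from \<open>l\<close> to
    \<open>l + Estar G v\<close>: all coordinates of the displacement stay between 0 and
    \<open>S\<close>, so the diagonal entry costs at most its absolute value times \<open>S\<close>,
    and the neighbours cost at most \<open>S\<close> each.\<close>
  define D where "D = (\<Sum>u\<in>UNIV. \<bar>of_int (decoration G u)\<bar>) * S + real CARD('v) * S"
  have S0: "0 \<le> S" using S nonneg by (meson order_trans)
  have D0: "0 \<le> D" unfolding D_def using S0 by (auto intro!: add_nonneg_nonneg mult_nonneg_nonneg sum_nonneg)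
  have step: "f (l + E v) = f l" if "deep S l" for l v
    using series_count_add_E[OF S that] by (simp add: f_def chi_add_E)
  have loss: "- D \<le> charge_of G (vec_of y) u" if "\<And>v. real (y v) \<le> S" for y u
  proof -
    have "of_int (decoration G u) * real (y u) \<le> \<bar>of_int (decoration G u)\<bar> * S"
      using that[of u] by (intro mult_mono) auto
    also have "\<dots> \<le> (\<Sum>u\<in>UNIV. \<bar>of_int (decoration G u)\<bar>) * S"
      using S0 by (intro mult_right_mono member_le_sum) auto
    finally have 1: "of_int (decoration G u) * real (y u) \<le> (\<Sum>u\<in>UNIV. \<bar>of_int (decoration G u)\<bar>) * S" .
    have "(\<Sum>w | adj G u w. real (y w)) \<le> (\<Sum>w | adj G u w. S)" by (rule sum_mono) (use that in auto)
    also have "\<dots> \<le> real CARD('v) * S"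
      using S0 by (simp add: card_mono mult_right_mono)
    finally show ?thesis using 1 by (simp add: charge_of_eq D_def vec_of_def)
  qed
  have path: "(\<forall>v. real (y v) \<le> S) \<Longrightarrow> f (l + vec_of y) = f l" if l: "deep (S + D) l" for l y
  proof (induction y rule: nat_fun_finite_induct)
    case zero
    have "vec_of (\<lambda>_. 0 :: nat) = (0 :: real ^ 'v)" by (simp add: vec_of_def vec_eq_iff)
    then show ?case by simp
  next
    case (Suc y v)
    have yS: "real (y u) \<le> S" for u
      using Suc.prems[rule_format, of u] by (auto split: if_splits)
    have "S \<le> charge_of G (l + vec_of y) u" for u
      using loss[of y u] yS l by (simp add: charge_of_add deep_def) (smt (verit))
    moreover have "l + vec_of y \<in> lattice"
      using l by (auto simp: deep_def vec_of_def lattice_def)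
    ultimately have "f (l + vec_of y + E v) = f (l + vec_of y)" by (intro step) (simp add: deep_def)
    moreover have "l + vec_of (y(v := Suc (y v))) = l + vec_of y + E v"
      by (auto simp: vec_of_def vec_eq_iff E_nth)
    ultimately show ?case using Suc.IH yS by metis
  qed
  have Estar: "f (l + Estar G v) = f l" if l: "deep (S + D) l" for l v
  proof -
    define y where "y u = nat \<lfloor>Estar G v $ u\<rfloor>" for u
    have y: "real (y u) = Estar G v $ u" for u
      using Estar_lattice[of v] nonneg[of v u] by (auto simp: y_def lattice_def elim!: Ints_cases dest!: spec[of _ u])
    have "vec_of y = Estar G v" by (simp add: vec_of_def vec_eq_iff y)
    then show ?thesis using path[OF l, of y] S y by simp
  qed
  \<comment> \<open>Rounded up to an integer, so that \<open>N *\<^sub>R \<rho>\<close> is a lattice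
    point.\<close>
  define N where "N = real (nat \<lceil>S + D\<rceil>)"
  have N: "S + D \<le> N" unfolding N_def by linarith
  have base: "deep (S + D) (N *\<^sub>R \<rho> + exponent G \<kappa>)" for \<kappa>
    unfolding deep_def
  proof (intro conjI allI)
    show "N *\<^sub>R \<rho> + exponent G \<kappa> \<in> lattice"
      by (intro lattice_add lattice_scale rho_lattice exponent_lattice) (simp add: N_def)
    show "S + D \<le> charge_of G (N *\<^sub>R \<rho> + exponent G \<kappa>) u" for u
      using N by (simp add: charge_of_add charge_of_scale charge_of_rho charge_of_exponent)
  qed
  have const: "f (N *\<^sub>R \<rho> + exponent G \<kappa>) = f (N *\<^sub>R \<rho>)" for \<kappa>
  proof (induction \<kappa> rule: nat_fun_finite_induct)
    case zero
    then show ?case by (simp add: exponent_def)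
  next
    case (Suc y v)
    then show ?case using Estar[OF base[of y], of v] by (simp only: exponent_upd_Suc add.assoc)
  qed
  show ?thesis
  proof (rule that[of N "f (N *\<^sub>R \<rho>)"])
    show "0 \<le> N" by (simp add: N_def)
    fix l assume l: "deep N l"
    define \<kappa> where "\<kappa> u = nat \<lfloor>charge_of G l u - N\<rfloor>" for u
    have \<kappa>: "real (\<kappa> u) = charge_of G l u - N" for u
    proof -
      have "charge_of G l u - N \<in> \<int>" "0 \<le> charge_of G l u - N"
        using l charge_of_Ints by (auto simp: deep_def N_def)
      then show ?thesis by (auto simp: \<kappa>_def elim!: Ints_cases)
    qed
    have "l = N *\<^sub>R \<rho> + exponent G \<kappa>"
      by (rule eq_if_charges_eq) (simp add: charge_of_add charge_of_scale charge_of_rho charge_of_exponent \<kappa>)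
    then show "?Q l = chi G l + f (N *\<^sub>R \<rho>)" using const[of \<kappa>] by (simp add: f_def)
  qed
qed

lemma ray_poly_chi: "\<exists>p. \<forall>t. chi G (l + t *\<^sub>R z) + c = poly p t"
proof (intro exI allI)
  fix t
  show "chi G (l + t *\<^sub>R z) + c
    = poly [:chi G l + c, - form G (canonical_class G) z / 2 - form G l z, - form G z z / 2:] t"
    by (simp add: chi_def form_add_left form_add_right form_scale_left form_scale_right form_sym[of z l]
        field_simps power2_eq_square)
qed

lemma real_polynomial_function_chi: "real_polynomial_function (\<lambda>l. chi G l + c)"
proof -
  have "bounded_linear (\<lambda>l. form G k l)" for k
    by (rule linear_conv_bounded_linear[THEN iffD1], rule linearI)
      (simp_all add: form_add_right form_scale_right)
  then have lin: "real_polynomial_function (\<lambda>l. form G k l)" for k by (rule real_polynomial_function.intros(1))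
  have nth: "real_polynomial_function (\<lambda>l :: real ^ 'v. l $ v)" for v
    by (intro real_polynomial_function.intros(1) bounded_linear_vec_nth)
  have "chi G l + c = (\<Sum>v\<in>UNIV. (-1/2) * (l $ v * form G (E v) l)) + ((-1/2) * form G (canonical_class G) l + c)" for l
  proof -
    have "form G l l = (\<Sum>v\<in>UNIV. l $ v * form G (E v) l)"
      by (subst form_expand) (simp add: form_sym)
    then show ?thesis unfolding chi_def sum_distrib_left[symmetric] by (simp add: add_divide_distrib)
  qed
  moreover have "real_polynomial_function (\<lambda>l. (\<Sum>v\<in>UNIV. (-1/2) * (l $ v * form G (E v) l)) + ((-1/2) * form G (canonical_class G) l + c))"
    by (intro real_polynomial_function_sum real_polynomial_function.intros(2-4) lin nth) auto
  ultimately show ?thesis by (simp only:)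
qed

text \<open>The constant \<open>c\<close> of \<open>Q = chi + c\<close> is a periodic constant
  because \<open>chi\<close> vanishes at 0. It is the only one: a competing quasipolynomial is
  polynomial along suitable multiples of \<open>\<rho>\<close>, agrees there eventually with
  \<open>chi + c\<close>, and hence also at 0.\<close>

lemma deep_periodic_constant:
  obtains N where "0 \<le> N"
    "\<And>l. deep N l \<Longrightarrow> series_count G (vertex_series G) l = chi G l + periodic_constant (lipman_cone G) (Z_coeff G)"
proof -
  let ?Q = "series_count G (vertex_series G)"
  obtain N c where N: "0 \<le> N" and Q: "\<And>l. deep N l \<Longrightarrow> ?Q l = chi G l + c"
    using series_count_eventually_chi by blast
  have chi0: "chi G 0 = 0" by (simp add: chi_def)
  have "is_periodic_constant (lipman_cone G) (Z_coeff G) c"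
    unfolding is_periodic_constant_def
  proof (intro exI conjI)
    show "N *\<^sub>R \<rho> \<in> lipman_cone G"
      using N by (simp add: lipman_cone_iff charge_of_scale charge_of_rho)
    show "finite_index_sublattice lattice lattice" by (rule lattice_finite_index)
    show "quasipolynomial_on lattice (\<lambda>l. chi G l + c)"
      unfolding quasipolynomial_on_def
      using lattice_finite_index real_polynomial_function_chi by blast
    show "\<forall>l\<in>lattice \<inter> (+) (N *\<^sub>R \<rho>) ` lipman_cone G. counting_function (Z_coeff G) l = chi G l + c"
    proof
      fix l assume l: "l \<in> lattice \<inter> (+) (N *\<^sub>R \<rho>) ` lipman_cone G"
      then have "deep N l"
        by (auto simp: deep_def lipman_cone_iff charge_of_add charge_of_scale charge_of_rho)
      then show "counting_function (Z_coeff G) l = chi G l + c" using Q by (simp add: counting_function_Z)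
    qed
    show "c = chi G 0 + c" by (simp add: chi0)
  qed
  moreover have "c' = c" if pc: "is_periodic_constant (lipman_cone G) (Z_coeff G) c'" for c'
  proof -
    obtain l0 L' Q' where L': "l0 \<in> lipman_cone G" "finite_index_sublattice L' lattice"
      and Q': "quasipolynomial_on L' Q'" "\<forall>l\<in>L' \<inter> (+) l0 ` lipman_cone G. counting_function (Z_coeff G) l = Q' l"
      and c': "c' = Q' 0"
      using pc unfolding is_periodic_constant_def by blast
    obtain M P where M: "finite_index_sublattice M L'"
      and P: "real_polynomial_function P" "\<forall>x\<in>M. Q' (0 + x) = P (0 + x)"
      using Q'(1) finite_index_sublatticeD(2)[OF L'(2)] unfolding quasipolynomial_on_def by blast
    have lat: "real t *\<^sub>R \<rho> \<in> lattice" for t :: nat by (intro lattice_scale rho_lattice) auto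
    \<comment> \<open>Two multiples are taken in turn, since \<open>L'\<close> has finite index in
      the lattice and the period lattice \<open>M\<close> has finite index in
      \<open>L'\<close>.\<close>
    obtain d :: nat where d: "0 < d" "real d *\<^sub>R \<rho> \<in> L'"
      using finite_index_sublattice_multiple[OF L'(2) lat] by blast
    have "real t *\<^sub>R (real d *\<^sub>R \<rho>) \<in> L'" for t :: nat
      by (rule finite_index_sublattice_scale[OF L'(2) d(2)])
    then obtain d' :: nat where d': "0 < d'" "real d' *\<^sub>R (real d *\<^sub>R \<rho>) \<in> M"
      using finite_index_sublattice_multiple[OF M] by blast
    define z where "z = real d' *\<^sub>R (real d *\<^sub>R \<rho>)"
    have zM: "real t *\<^sub>R z \<in> M" for t :: nat
      unfolding z_def by (rule finite_index_sublattice_scale[OF M d'(2)])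
    have zL: "real t *\<^sub>R z \<in> L'" for t :: nat using zM finite_index_sublatticeD(1)[OF M] by blast
    have zlat: "real t *\<^sub>R z \<in> lattice" for t :: nat
      using zL finite_index_sublatticeD(1)[OF L'(2)] by blast
    have zch: "charge_of G (real t *\<^sub>R z) u \<ge> real t" for t u
    proof -
      have "real t * 1 \<le> real t * (real d' * real d)"
        using d d' by (intro mult_left_mono) (auto simp flip: of_nat_mult)
      then show ?thesis by (simp add: z_def charge_of_scale charge_of_rho)
    qed
    obtain p where p: "\<forall>t. P (0 + t *\<^sub>R z) = poly p t"
      using real_polynomial_function_ray[OF P(1)] by blast
    obtain q where q: "\<forall>t. chi G (0 + t *\<^sub>R z) + c = poly q t"
      using ray_poly_chi by blast
    have "\<forall>\<^sub>F t::nat in sequentially. N + (\<Sum>u\<in>UNIV. \<bar>charge_of G l0 u\<bar>) < real t"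
      using filterlim_real_sequentially unfolding filterlim_at_top_dense by blast
    then have "\<forall>\<^sub>F t::nat in sequentially. poly p (real t) = poly q (real t)"
    proof eventually_elim
      case (elim t)
      have big: "N + \<bar>charge_of G l0 u\<bar> \<le> charge_of G (real t *\<^sub>R z) u" for u
        using zch[of t u] elim member_le_sum[of u UNIV "\<lambda>u. \<bar>charge_of G l0 u\<bar>"] by simp
      have "N \<le> charge_of G (real t *\<^sub>R z) u" for u using big[of u] by linarith
      then have "deep N (real t *\<^sub>R z)" using zlat by (simp add: deep_def)
      moreover have "real t *\<^sub>R z - l0 \<in> lipman_cone G"
        unfolding lipman_cone_iff charge_of_diff
      proof
        show "0 \<le> charge_of G (real t *\<^sub>R z) u - charge_of G l0 u" for u
          using big[of u] N by linarith
      qed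
      then have "real t *\<^sub>R z \<in> (+) l0 ` lipman_cone G"
        by (intro image_eqI[of _ _ "real t *\<^sub>R z - l0"]) auto
      ultimately have "Q' (real t *\<^sub>R z) = chi G (real t *\<^sub>R z) + c"
        using Q'(2)[rule_format, of "real t *\<^sub>R z"] zL[of t] Q[of "real t *\<^sub>R z"]
        by (simp add: counting_function_Z del: image_iff)
      then show ?case using P(2) zM p q by (metis add_0)
    qed
    then have "p = q" by (rule poly_eq_if_eventually)
    then have "P 0 = chi G 0 + c" using p[rule_format, of 0] q[rule_format, of 0] by simp
    then show ?thesis using c' P(2) finite_index_sublatticeD(2)[OF M] chi0 by simp
  qed
  ultimately have "periodic_constant (lipman_cone G) (Z_coeff G) = c"
    unfolding periodic_constant_def by (rule the_equality)
  then show ?thesis using that[of N] N Q by simp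
qed

section \<open>From the Ehrhart count to the counting function of \<open>Z\<close>\<close>

lemma series_count_mult_one_minus_X:
  "series_count G (f(n := (1 - fps_X) * f n)) l = series_count G f l - series_count G f (l - Estar G n)"
proof -
  let ?K = "\<lambda>l. {\<kappa>. \<not> l \<le> exponent G \<kappa>}"
  let ?R = "\<lambda>\<kappa>. \<Prod>v\<in>UNIV - {n}. fps_nth (f v) (\<kappa> v)"
  let ?h = "\<lambda>\<kappa> :: 'v \<Rightarrow> nat. \<kappa>(n := Suc (\<kappa> n))"
  have nth: "fps_nth ((1 - fps_X) * f n) k = fps_nth (f n) k - (if k = 0 then 0 else fps_nth (f n) (k - 1))" for k
    by (simp add: left_diff_distrib)
  have "series_count G (f(n := (1 - fps_X) * f n)) l
      = (\<Sum>\<kappa>\<in>?K l. fps_nth ((1 - fps_X) * f n) (\<kappa> n) * ?R \<kappa>)"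
    unfolding series_count_def by (intro sum.cong refl) (simp add: prod.remove[of UNIV n])
  also have "\<dots> = (\<Sum>\<kappa>\<in>?K l. fps_nth (f n) (\<kappa> n) * ?R \<kappa>)
     - (\<Sum>\<kappa>\<in>?K l. (if \<kappa> n = 0 then 0 else fps_nth (f n) (\<kappa> n - 1)) * ?R \<kappa>)"
    unfolding nth by (subst sum_subtractf[symmetric]) (simp only: left_diff_distrib)
  also have "(\<Sum>\<kappa>\<in>?K l. fps_nth (f n) (\<kappa> n) * ?R \<kappa>) = series_count G f l"
    unfolding series_count_def by (intro sum.cong refl) (simp add: prod.remove[of UNIV n])
  \<comment> \<open>Raising \<open>\<kappa> n\<close> by one raises the exponent by
    \<open>Estar G n\<close>, so this sum is the count at \<open>l - Estar G n\<close>; families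
    with \<open>\<kappa> n = 0\<close> contribute nothing to it.\<close>
  also have "(\<Sum>\<kappa>\<in>?K l. (if \<kappa> n = 0 then 0 else fps_nth (f n) (\<kappa> n - 1)) * ?R \<kappa>)
     = (\<Sum>\<kappa>\<in>?h ` ?K (l - Estar G n). (if \<kappa> n = 0 then 0 else fps_nth (f n) (\<kappa> n - 1)) * ?R \<kappa>)"
  proof (rule sum.mono_neutral_right[OF finite_not_le_exponent])
    show "?h ` ?K (l - Estar G n) \<subseteq> ?K l"
      by (auto simp: exponent_upd_Suc diff_le_eq)
    show "\<forall>\<kappa>\<in>?K l - ?h ` ?K (l - Estar G n). (if \<kappa> n = 0 then 0 else fps_nth (f n) (\<kappa> n - 1)) * ?R \<kappa> = 0"
    proof
      fix \<kappa> assume \<kappa>: "\<kappa> \<in> ?K l - ?h ` ?K (l - Estar G n)"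
      have "\<kappa> n = 0"
      proof (rule ccontr)
        assume "\<kappa> n \<noteq> 0"
        define \<kappa>' where "\<kappa>' = \<kappa>(n := \<kappa> n - 1)"
        have eq: "\<kappa> = ?h \<kappa>'" using \<open>\<kappa> n \<noteq> 0\<close> by (auto simp: \<kappa>'_def)
        then have "exponent G \<kappa> = exponent G \<kappa>' + Estar G n" using exponent_upd_Suc by metis
        then have "\<kappa>' \<in> ?K (l - Estar G n)" using \<kappa> by (simp add: diff_le_eq)
        then show False using \<kappa> eq by blast
      qed
      then show "(if \<kappa> n = 0 then 0 else fps_nth (f n) (\<kappa> n - 1)) * ?R \<kappa> = 0" by simp
    qed
  qed
  also have "\<dots> = (\<Sum>\<kappa>\<in>?K (l - Estar G n). fps_nth (f n) (\<kappa> n) * ?R \<kappa>)"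
  proof (subst sum.reindex)
    show "inj_on ?h (?K (l - Estar G n))"
    proof (rule inj_onI)
      fix a b assume eq: "?h a = ?h b"
      have "a x = b x" for x using fun_cong[OF eq, of x] by (cases "x = n") auto
      then show "a = b" by auto
    qed
    have "?R (?h \<kappa>) = ?R \<kappa>" for \<kappa> by (intro prod.cong) auto
    then show "sum ((\<lambda>\<kappa>. (if \<kappa> n = 0 then 0 else fps_nth (f n) (\<kappa> n - 1)) * ?R \<kappa>) \<circ> ?h) (?K (l - Estar G n))
      = (\<Sum>\<kappa>\<in>?K (l - Estar G n). fps_nth (f n) (\<kappa> n) * ?R \<kappa>)" by simp
  qed
  also have "\<dots> = series_count G f (l - Estar G n)"
    unfolding series_count_def by (intro sum.cong refl) (simp add: prod.remove[of UNIV n])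
  finally show ?thesis .
qed

lemma series_count_diffs:
  assumes "distinct ns"
  shows "series_count G (\<lambda>v. if v \<in> set ns then (1 - fps_X) ^ m v * f v else f v)
    = diffs (Estar G) m ns (series_count G f)"
  using assms
proof (induction ns)
  case Nil
  then show ?case by simp
next
  case (Cons n ns)
  let ?f = "\<lambda>v. if v \<in> set ns then (1 - fps_X) ^ m v * f v else f v"
  have pow: "series_count G (?f(n := (1 - fps_X) ^ j * f n)) = (nab (Estar G n) ^^ j) (series_count G ?f)" for j
  proof (induction j)
    case 0
    have "?f(n := f n) = ?f" using Cons.prems by auto
    then show ?case by simp
  next
    case (Suc j)
    have "?f(n := (1 - fps_X) ^ Suc j * f n)
      = (?f(n := (1 - fps_X) ^ j * f n))(n := (1 - fps_X) * (?f(n := (1 - fps_X) ^ j * f n)) n)"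
      by (simp add: mult.assoc)
    then have "series_count G (?f(n := (1 - fps_X) ^ Suc j * f n))
      = nab (Estar G n) (series_count G (?f(n := (1 - fps_X) ^ j * f n)))"
      unfolding nab_def by (intro ext) (simp only: series_count_mult_one_minus_X)
    then show ?case by (simp only: Suc.IH funpow.simps comp_def)
  qed
  have "(\<lambda>v. if v \<in> set (n # ns) then (1 - fps_X) ^ m v * f v else f v) = ?f(n := (1 - fps_X) ^ m n * f n)"
    using Cons.prems by auto
  then show ?case using pow Cons by simp
qed

lemma series_count_ends:
  "series_count G (\<lambda>v. if v \<in> ends G then inverse (1 - fps_X) else 1) l = real (ehrhart_count G l)"
proof -
  let ?X = "{x \<in> ends G \<rightarrow>\<^sub>E (UNIV :: nat set). \<not> l \<le> (\<Sum>e\<in>ends G. real (x e) *\<^sub>R Estar G e)}"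
  let ?g = "\<lambda>(x :: 'v \<Rightarrow> nat) v. if v \<in> ends G then x v else 0"
  let ?K = "{\<kappa>. \<not> l \<le> exponent G \<kappa>}"
  let ?K' = "{\<kappa> \<in> ?K. \<forall>v. v \<notin> ends G \<longrightarrow> \<kappa> v = 0}"
  have exp: "exponent G \<kappa> = (\<Sum>e\<in>ends G. real (\<kappa> e) *\<^sub>R Estar G e)" if "\<forall>v. v \<notin> ends G \<longrightarrow> \<kappa> v = 0" for \<kappa>
    unfolding exponent_def by (rule sum.mono_neutral_right) (use that in auto)
  have exp_g: "exponent G (?g x) = (\<Sum>e\<in>ends G. real (x e) *\<^sub>R Estar G e)" for x
    by (subst exp) (auto intro: sum.cong)
  have "bij_betw ?g ?X ?K'"
    unfolding bij_betw_def
  proof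
    show "inj_on ?g ?X"
    proof (rule inj_onI)
      fix x y assume xy: "x \<in> ?X" "y \<in> ?X" "?g x = ?g y"
      have "x v = y v" for v
        using fun_cong[OF xy(3), of v] xy(1,2) by (cases "v \<in> ends G") (auto simp: PiE_iff extensional_def)
      then show "x = y" by auto
    qed
    show "?g ` ?X = ?K'"
    proof (intro equalityI subsetI)
      fix \<kappa> assume "\<kappa> \<in> ?g ` ?X"
      then show "\<kappa> \<in> ?K'" using exp_g by auto
    next
      fix \<kappa> assume \<kappa>: "\<kappa> \<in> ?K'"
      then have 1: "restrict \<kappa> (ends G) \<in> ?X" using exp[of \<kappa>] by auto
      have 2: "\<kappa> = ?g (restrict \<kappa> (ends G))" using \<kappa> by auto
      show "\<kappa> \<in> ?g ` ?X" by (rule image_eqI[of _ ?g, OF 2 1])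
    qed
  qed
  then have "card ?X = card ?K'" by (rule bij_betw_same_card)
  moreover have "(\<Prod>v\<in>UNIV. fps_nth (if v \<in> ends G then inverse (1 - fps_X) else 1) (\<kappa> v))
      = (if \<forall>v. v \<notin> ends G \<longrightarrow> \<kappa> v = 0 then 1 else (0::real))" for \<kappa>
  proof (cases "\<forall>v. v \<notin> ends G \<longrightarrow> \<kappa> v = 0")
    case True
    then show ?thesis by (auto intro!: prod.neutral simp: fps_nth_inverse_one_minus_X)
  next
    case False
    then obtain v where "v \<notin> ends G" "\<kappa> v \<noteq> 0" by blast
    then show ?thesis using False by (auto intro!: prod_zero bexI[of _ v])
  qed
  ultimately show ?thesis
    by (simp add: series_count_def ehrhart_count_def sum.If_cases[OF finite_not_le_exponent] Collect_conj_eq[symmetric])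
qed

text \<open>In a connected graph a vertex without neighbours is the only vertex, and then there is
  no node.\<close>

lemma valency_pos:
  assumes "nodes G \<noteq> {}"
  shows "0 < valency G v"
proof (rule ccontr)
  assume "\<not> 0 < valency G v"
  then have none: "{w. adj G v w} = {}" by (simp add: valency_def)
  have "w = v" for w
    using adj_connected[of v w] by (induction rule: rtranclp_induct) (use none in auto)
  then have "nodes G = {}" using \<open>\<not> 0 < valency G v\<close> by (auto simp: nodes_def) (metis not_less_zero numeral_3_eq_3 not_less_eq_eq zero_less_Suc le0)
  then show False using assms by simp
qed

text \<open>A ray whose direction is interior to the chamber and the Lipman cone eventually enters
  both from any lattice point. In the chamber \<open>LC\<close> is the Ehrhart count, and deep in
  the cone \<open>Q\<close> is known; polynomiality along the ray then carries the equality back to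
  its starting point.\<close>

lemma diffs_ehrhart_quasipolynomial:
  assumes nodes: "nodes G \<noteq> {}" and chamber: "is_chamber G C"
    and int: "interior (C \<inter> lipman_cone G) \<noteq> {}"
    and LC: "is_ehrhart_quasipolynomial G C LC"
    and ns: "distinct ns" "set ns = nodes G" and l: "l \<in> lattice"
  shows "diffs (Estar G) (\<lambda>n. valency G n - 2) ns LC l
    = chi G l + periodic_constant (lipman_cone G) (Z_coeff G)"
proof -
  let ?pc = "periodic_constant (lipman_cone G) (Z_coeff G)"
  let ?m = "\<lambda>n. valency G n - 2"
  let ?A = "C \<inter> lipman_cone G"
  have cone: "c *\<^sub>R x \<in> ?A" if "x \<in> ?A" "0 \<le> c" for x c
  proof -
    obtain F where F: "C = \<Inter>F" "F \<subseteq> basis_cones G" using chamber by (auto simp: is_chamber_def)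
    have "convex_cone C" unfolding F(1)
      using F(2) by (intro convex_cone_Inter) (auto simp: basis_cones_def convex_cone_convex_cone_hull)
    then show ?thesis using that by (auto simp: lipman_cone_iff charge_of_scale convex_cone_scaleR)
  qed
  obtain z0 c0 where z0: "z0 \<in> lattice" "0 < c0" "c0 *\<^sub>R z0 \<in> interior ?A"
    using lattice_ray_in_open[OF open_interior int] by blast
  obtain d :: nat where d: "0 < d" "ray_poly (real d *\<^sub>R z0) LC"
    using quasipolynomial_ray_poly[OF _ z0(1)] LC by (auto simp: is_ehrhart_quasipolynomial_def)
  define z where "z = real d *\<^sub>R z0"
  have z: "z \<in> lattice" unfolding z_def by (intro lattice_scale z0) auto
  have ev: "\<forall>\<^sub>F t::nat in sequentially. l + real t *\<^sub>R z \<in> ?A" for l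
    by (rule cone_ray_eventually[OF cone, where c = "c0 / real d"]) (use z0 d in \<open>auto simp: z_def\<close>)
  have lat: "l + real t *\<^sub>R z \<in> lattice" if "l \<in> lattice" for l and t :: nat
    by (intro lattice_add lattice_scale that z) auto
  have "eq_on_rays z LC (\<lambda>l. real (ehrhart_count G l))"
    unfolding eq_on_rays_def
  proof
    fix l :: "real ^ 'v" assume l: "l \<in> lattice"
    show "\<forall>\<^sub>F t::nat in sequentially. LC (l + real t *\<^sub>R z) = real (ehrhart_count G (l + real t *\<^sub>R z))"
      using ev[of l] by eventually_elim (use LC lat[OF l] in \<open>auto simp: is_ehrhart_quasipolynomial_def\<close>)
  qed
  then have "eq_on_rays z (diffs (Estar G) ?m ns LC) (diffs (Estar G) ?m ns (\<lambda>l. real (ehrhart_count G l)))"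
    by (intro eq_on_rays_diffs Estar_lattice)
  also have "diffs (Estar G) ?m ns (\<lambda>l. real (ehrhart_count G l)) = series_count G (vertex_series G)"
  proof -
    \<comment> \<open>No valency is 0, so \<open>Z\<close> is the generating series of the ends
      times \<open>1 - T\<close> to the power valency minus 2 at each node; vertices of valency 2
      contribute the factor 1.\<close>
    let ?f = "\<lambda>v. if v \<in> ends G then inverse (1 - fps_X) else 1 :: real fps"
    have "(\<lambda>v. if v \<in> set ns then (1 - fps_X) ^ ?m v * ?f v else ?f v) = vertex_series G"
    proof
      fix v
      consider "valency G v = 1" | "valency G v = 2" | k where "valency G v = k + 3"
        using valency_pos[OF nodes, of v] by (metis One_nat_def Suc_leI le_Suc_ex add.commute le_antisym not_less_eq_eq numeral_2_eq_2 numeral_3_eq_3)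
      then show "(if v \<in> set ns then (1 - fps_X) ^ ?m v * ?f v else ?f v) = vertex_series G v"
        by cases (auto simp: ns(2) nodes_def ends_def vertex_series_def power_int_def nat_add_distrib)
    qed
    then show ?thesis
      using series_count_diffs[OF ns(1), of ?m ?f] series_count_ends by presburger
  qed
  also have "eq_on_rays z (series_count G (vertex_series G)) (\<lambda>l. chi G l + ?pc)"
    unfolding eq_on_rays_def
  proof
    fix l :: "real ^ 'v" assume l: "l \<in> lattice"
    obtain N where N: "0 \<le> N" "\<And>l. deep N l \<Longrightarrow> series_count G (vertex_series G) l = chi G l + ?pc"
      using deep_periodic_constant by blast
    show "\<forall>\<^sub>F t::nat in sequentially. series_count G (vertex_series G) (l + real t *\<^sub>R z) = chi G (l + real t *\<^sub>R z) + ?pc"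
      \<comment> \<open>Starting the ray lower by \<open>N *\<^sub>R \<rho>\<close> turns membership
        in the cone into charges of at least \<open>N\<close>.\<close>
      using ev[of "l - N *\<^sub>R \<rho>"]
    proof eventually_elim
      case (elim t)
      then have "deep N (l + real t *\<^sub>R z)"
        using lat[OF l] by (simp add: deep_def lipman_cone_iff charge_of_add charge_of_diff charge_of_scale charge_of_rho) (smt (verit))
      then show ?case by (rule N(2))
    qed
  qed
  finally have eq: "eq_on_rays z (diffs (Estar G) ?m ns LC) (\<lambda>l. chi G l + ?pc)" .
  show ?thesis
  proof (rule ray_poly_eqD[OF _ _ eq l])
    show "ray_poly z (diffs (Estar G) ?m ns LC)"
      using d(2) by (intro ray_poly_diffs Estar_lattice) (simp add: z_def)
    show "ray_poly z (\<lambda>l. chi G l + ?pc)"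
      unfolding ray_poly_def using ray_poly_chi by metis
  qed
qed

end

section \<open>Coefficients of the Ehrhart quasipolynomial\<close>

lemma nab_apply: "nab w f x = f x - f (x - w)"
  by (simp add: nab_def)

lemma nab_commute: "nab v (nab w f) = nab w (nab v f)"
  by (auto simp: nab_def fun_eq_iff algebra_simps)

lemma nab_pow_commute: "(nab v ^^ j) (nab w f) = nab w ((nab v ^^ j) f)"
  by (induction j) (auto simp: nab_commute[of w])

lemma nab_pow_pow_commute: "(nab v ^^ j) ((nab w ^^ i) f) = (nab w ^^ i) ((nab v ^^ j) f)"
  by (induction i) (auto simp: nab_pow_commute)

lemma diffs_pow_commute: "diffs s m ns ((nab w ^^ i) f) = (nab w ^^ i) (diffs s m ns f)"
  by (induction ns) (auto simp: nab_pow_pow_commute[where w = w])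

lemma nab_pow_sum: "(nab w ^^ j) (\<lambda>x. \<Sum>i\<in>A. c i * f i x) = (\<lambda>x. \<Sum>i\<in>A. c i * (nab w ^^ j) (f i) x)"
  by (induction j) (auto simp: nab_def sum_subtractf[symmetric] right_diff_distrib)

lemma diffs_sum: "diffs s m ns (\<lambda>x. \<Sum>i\<in>A. c i * f i x) = (\<lambda>x. \<Sum>i\<in>A. c i * diffs s m ns (f i) x)"
  by (induction ns) (auto simp: nab_pow_sum)

lemma nab_pow_diff: "(nab w ^^ j) (\<lambda>x. f x - g x) = (\<lambda>x. (nab w ^^ j) f x - (nab w ^^ j) g x)"
  by (induction j) (auto simp: nab_def)

lemma diffs_diff: "diffs s m ns (\<lambda>x. f x - g x) = (\<lambda>x. diffs s m ns f x - diffs s m ns g x)"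
  by (induction ns) (auto simp: nab_pow_diff)

lemma nab_pow_cong_on:
  assumes "\<And>x. x \<in> S \<Longrightarrow> x - w \<in> S" "\<And>x. x \<in> S \<Longrightarrow> f x = g x" "x \<in> S"
  shows "(nab w ^^ j) f x = (nab w ^^ j) g x"
  using assms(3) by (induction j arbitrary: x) (auto simp: nab_def assms(1,2))

lemma diffs_cong_on:
  assumes "\<And>x n. x \<in> S \<Longrightarrow> n \<in> set ns \<Longrightarrow> x - s n \<in> S" "\<And>x. x \<in> S \<Longrightarrow> f x = g x" "x \<in> S"
  shows "diffs s m ns f x = diffs s m ns g x"
  using assms(1,3)
proof (induction ns arbitrary: x)
  case Nil
  then show ?case using assms(2) by simp
next
  case (Cons n ns)
  show ?case
    unfolding diffs_Cons by (rule nab_pow_cong_on[of S]) (use Cons in auto)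
qed

lemma nab_pow_zero_on:
  assumes "\<And>x. x \<in> S \<Longrightarrow> x - w \<in> S" "\<And>x. x \<in> S \<Longrightarrow> f x = 0" "x \<in> S"
  shows "(nab w ^^ j) f x = 0"
  using assms(3) by (induction j arbitrary: x) (auto simp: nab_def assms(1,2))

text \<open>A difference with step \<open>d w\<close> is a sum of \<open>d\<close> translates of the
  difference with step \<open>w\<close>. Within the induction, a function annihilated by
  \<open>nab w\<close> on \<open>S\<close> is constant along
  \<open>x, x - w, ..., x - d w\<close>.\<close>

lemma nab_scale_zero_on:
  fixes w :: "'a::real_vector"
  assumes closed: "\<And>x. x \<in> S \<Longrightarrow> x - w \<in> S" and zero: "\<And>x. x \<in> S \<Longrightarrow> (nab w ^^ j) f x = 0" and x: "x \<in> S"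
  shows "(nab (real d *\<^sub>R w) ^^ j) f x = 0"
  using zero x
proof (induction j arbitrary: f x)
  case 0
  then show ?case by simp
next
  case (Suc j)
  let ?g = "(nab (real d *\<^sub>R w) ^^ j) f"
  have "(nab (real d *\<^sub>R w) ^^ j) (nab w f) x = 0" if "x \<in> S" for x
    by (rule Suc.IH[OF _ that]) (use Suc.prems(1) in \<open>simp add: nab_pow_commute\<close>)
  then have "nab w ?g x = 0" if "x \<in> S" for x
    using that by (simp only: nab_pow_commute)
  then have step: "?g (x - w) = ?g x" if "x \<in> S" for x
    using that by (simp add: nab_apply)
  have "x - real t *\<^sub>R w \<in> S \<and> ?g (x - real t *\<^sub>R w) = ?g x" for t
  proof (induction t)
    case (Suc t)
    have "x - real (Suc t) *\<^sub>R w = x - real t *\<^sub>R w - w" by (simp add: algebra_simps)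
    then show ?case using Suc step[of "x - real t *\<^sub>R w"] closed by metis
  qed (use \<open>x \<in> S\<close> in simp)
  from this[of d] show ?case
    by (simp only: funpow.simps comp_apply) (subst nab_apply, simp)
qed

lemma diffs_scale_zero_on:
  fixes s :: "'v \<Rightarrow> 'a::real_vector"
  assumes closed: "\<And>x n. x \<in> S \<Longrightarrow> n \<in> set ns \<Longrightarrow> x - s n \<in> S"
    and zero: "\<And>x. x \<in> S \<Longrightarrow> diffs s m ns f x = 0" and x: "x \<in> S"
  shows "diffs (\<lambda>n. real d *\<^sub>R s n) m ns f x = 0"
  using assms
proof (induction ns arbitrary: f x)
  case Nil
  then show ?case by simp
next
  case (Cons n ns)
  have "(nab (real d *\<^sub>R s n) ^^ m n) (diffs s m ns f) x = 0" if "x \<in> S" for x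
    by (rule nab_scale_zero_on[of S]) (use Cons.prems that in auto)
  then have "diffs (\<lambda>n. real d *\<^sub>R s n) m ns ((nab (real d *\<^sub>R s n) ^^ m n) f) x = 0"
    using Cons.prems by (intro Cons.IH) (auto simp: diffs_pow_commute)
  then show ?case by (simp add: diffs_pow_commute)
qed

lemma diffs_mono_zero_on:
  assumes closed: "\<And>x n. x \<in> S \<Longrightarrow> n \<in> set ns \<Longrightarrow> x - s n \<in> S"
    and zero: "\<And>x. x \<in> S \<Longrightarrow> diffs s a ns f x = 0" and x: "x \<in> S"
    and le: "\<And>n. n \<in> set ns \<Longrightarrow> a n \<le> m n"
  shows "diffs s m ns f x = 0"
  using assms
proof (induction ns arbitrary: f x)
  case Nil
  then show ?case by simp
next
  case (Cons n ns)
  have zero: "diffs s m ns ((nab (s n) ^^ a n) f) x = 0" if "x \<in> S" for x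
    using Cons.prems that by (intro Cons.IH) (auto simp: diffs_pow_commute)
  have "(nab (s n) ^^ (m n - a n)) ((nab (s n) ^^ a n) (diffs s m ns f)) x = 0"
  proof (rule nab_pow_zero_on[of S, rotated])
    show "(nab (s n) ^^ a n) (diffs s m ns f) x = 0" if "x \<in> S" for x
      using zero[OF that]
      by (simp only: diffs_pow_commute)
  qed (use Cons.prems in auto)
  then show ?case using Cons.prems(4)[of n] by (simp flip: funpow_add[unfolded comp_def, THEN fun_cong])
qed

section \<open>Backward differences of divided powers\<close>

definition divided_power :: "nat \<Rightarrow> real \<Rightarrow> real" where
  "divided_power i x = x ^ i / fact i"

lemma nab_divided_power:
  "nab c (divided_power i) = (\<lambda>x. \<Sum>k<i. - ((- c) ^ (i - k)) / fact (i - k) * divided_power k x)"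
proof
  fix x
  have "(x - c) ^ i / fact i = (\<Sum>k\<le>i. (- c) ^ (i - k) / fact (i - k) * divided_power k x)"
    using binomial_ring[of x "- c" i]
    by (simp add: sum_divide_distrib divided_power_def binomial_fact field_simps)
  also have "\<dots> = divided_power i x + (\<Sum>k<i. (- c) ^ (i - k) / fact (i - k) * divided_power k x)"
    by (simp add: lessThan_Suc_atMost[symmetric])
  finally show "nab c (divided_power i) x = (\<Sum>k<i. - ((- c) ^ (i - k)) / fact (i - k) * divided_power k x)"
    by (simp add: nab_def divided_power_def sum_negf)
qed

lemma nab_pow_Suc_divided_power:
  "(nab c ^^ Suc j) (divided_power i) x
    = (\<Sum>k<i. - ((- c) ^ (i - k)) / fact (i - k) * (nab c ^^ j) (divided_power k) x)"
  by (simp only: funpow_Suc_right comp_def nab_divided_power nab_pow_sum)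

lemma nab_pow_divided_power_less: "i < j \<Longrightarrow> (nab c ^^ j) (divided_power i) x = 0"
proof (induction j arbitrary: i)
  case (Suc j)
  then show ?case unfolding nab_pow_Suc_divided_power by (intro sum.neutral) auto
qed simp

text \<open>Powers below \<open>j\<close> are annihilated by \<open>j\<close> differences. Writing
  the power as \<open>j + i\<close> leaves a recursion in \<open>j\<close> with \<open>i\<close>
  terms, whose coefficients do not depend on \<open>j\<close>.\<close>

lemma nab_pow_Suc_divided_power':
  "(nab c ^^ Suc j) (divided_power (j + i)) x
    = (\<Sum>k<i. - ((- c) ^ (i - k)) / fact (i - k) * (nab c ^^ j) (divided_power (j + k)) x)"
proof -
  have "(nab c ^^ Suc j) (divided_power (j + i)) x
    = (\<Sum>k\<in>{j..<j + i}. - ((- c) ^ (j + i - k)) / fact (j + i - k) * (nab c ^^ j) (divided_power k) x)"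
    unfolding nab_pow_Suc_divided_power
    by (rule sum.mono_neutral_right) (auto simp: nab_pow_divided_power_less)
  also have "\<dots> = (\<Sum>k\<in>{0..<i}. - ((- c) ^ (i - k)) / fact (i - k) * (nab c ^^ j) (divided_power (j + k)) x)"
    using sum.shift_bounds_nat_ivl[of "\<lambda>k. - ((- c) ^ (j + i - k)) / fact (j + i - k) * (nab c ^^ j) (divided_power k) x" 0 j i]
    by (simp add: add.commute)
  finally show ?thesis by (simp add: atLeast0LessThan)
qed

lemma nab_pow_divided_power_self: "(nab c ^^ j) (divided_power j) x = c ^ j"
proof (induction j)
  case 0
  then show ?case by (simp add: divided_power_def)
next
  case (Suc j)
  then show ?case using nab_pow_Suc_divided_power'[of j c 1 x] by simp
qed

text \<open>With \<open>D\<close> the derivative, \<open>nab 1 = 1 - exp (-D)\<close>, whose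
  \<open>j\<close>-th power starts with \<open>D^j (1 - j D / 2)\<close>.\<close>

lemma nab_pow_divided_power_Suc: "(nab 1 ^^ j) (divided_power (Suc j)) x = x - real j / 2"
proof (induction j)
  case 0
  then show ?case by (simp add: divided_power_def)
next
  case (Suc j)
  then show ?case
    using nab_pow_Suc_divided_power'[of j 1 2 x]
    by (simp add: numeral_2_eq_2 nab_pow_divided_power_self field_simps del: funpow.simps)
qed

text \<open>The next term of the same expansion has coefficient
  \<open>j / 6 + j (j - 1) / 8 = j^2 / 8 + j / 24\<close>. Completing the square leaves
  \<open>j / 24\<close>, the source of the denominator 24 in the theorem.\<close>

lemma nab_pow_divided_power_Suc_Suc:
  "(nab 1 ^^ j) (divided_power (Suc (Suc j))) x = (x - real j / 2)\<^sup>2 / 2 + real j / 24"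
proof (induction j)
  case 0
  then show ?case by (simp add: divided_power_def power2_eq_square)
next
  case (Suc j)
  then show ?case
    using nab_pow_Suc_divided_power'[of j 1 3 x]
    by (simp add: numeral_3_eq_3 nab_pow_divided_power_self nab_pow_divided_power_Suc power2_eq_square
        field_simps del: funpow.simps)
qed

definition prod_fun :: "'v set \<Rightarrow> ('v \<Rightarrow> real \<Rightarrow> real) \<Rightarrow> real ^ 'v::finite \<Rightarrow> real" where
  "prod_fun N \<phi> x = (\<Prod>n\<in>N. \<phi> n (x $ n))"

lemma nab_prod_fun:
  assumes "n \<in> N"
  shows "nab (c *\<^sub>R E n) (prod_fun N \<phi>) = prod_fun N (\<phi>(n := nab c (\<phi> n)))"
proof
  fix x :: "real ^ 'a"
  have "prod_fun N \<psi> x = \<psi> n (x $ n) * (\<Prod>k\<in>N - {n}. \<psi> k (x $ k))" for \<psi> x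
    unfolding prod_fun_def by (rule prod.remove) (use assms in auto)
  moreover have "(\<Prod>k\<in>N - {n}. \<phi> k ((x - c *\<^sub>R E n) $ k)) = (\<Prod>k\<in>N - {n}. \<phi> k (x $ k))"
    by (rule prod.cong) (auto simp: E_nth)
  moreover have "(\<Prod>k\<in>N - {n}. (\<phi>(n := nab c (\<phi> n))) k (x $ k)) = (\<Prod>k\<in>N - {n}. \<phi> k (x $ k))"
    by (rule prod.cong) auto
  ultimately show "nab (c *\<^sub>R E n) (prod_fun N \<phi>) x = prod_fun N (\<phi>(n := nab c (\<phi> n))) x"
    by (simp add: nab_def E_nth left_diff_distrib)
qed

lemma nab_pow_prod_fun:
  assumes "n \<in> N"
  shows "(nab (c *\<^sub>R E n) ^^ j) (prod_fun N \<phi>) = prod_fun N (\<phi>(n := (nab c ^^ j) (\<phi> n)))"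
  by (induction j) (simp_all add: nab_prod_fun[OF assms] del: fun_upd_apply add: fun_upd_same)

lemma diffs_prod_fun:
  assumes "distinct ns" "set ns \<subseteq> N"
  shows "diffs (\<lambda>n. c *\<^sub>R E n) m ns (prod_fun N \<phi>)
    = prod_fun N (\<lambda>n. if n \<in> set ns then (nab c ^^ m n) (\<phi> n) else \<phi> n)"
  using assms
proof (induction ns)
  case Nil
  then show ?case by simp
next
  case (Cons n ns)
  let ?\<psi> = "\<lambda>k. if k \<in> set ns then (nab c ^^ m k) (\<phi> k) else \<phi> k"
  have "?\<psi>(n := (nab c ^^ m n) (?\<psi> n)) = (\<lambda>k. if k \<in> set (n # ns) then (nab c ^^ m k) (\<phi> k) else \<phi> k)"
    using Cons.prems by auto
  then show ?case using Cons by (simp add: nab_pow_prod_fun)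
qed

section \<open>Expressions with periodic coefficients\<close>

lemma finite_index_common_multiple:
  fixes s :: "'i \<Rightarrow> 'a::real_vector"
  assumes "finite I" "finite A"
    and M: "\<And>i. i \<in> A \<Longrightarrow> finite_index_sublattice (M i) L" and s: "\<And>n t. n \<in> I \<Longrightarrow> real t *\<^sub>R s n \<in> L"
  obtains d :: nat where "0 < d" "\<And>i n. i \<in> A \<Longrightarrow> n \<in> I \<Longrightarrow> real d *\<^sub>R s n \<in> M i"
proof -
  have "\<exists>d::nat. 0 < d \<and> (i \<in> A \<longrightarrow> n \<in> I \<longrightarrow> real d *\<^sub>R s n \<in> M i)" for i n
  proof (cases "i \<in> A \<and> n \<in> I")
    case True
    then have "\<And>t::nat. real t *\<^sub>R s n \<in> L" using s by blast
    then obtain d :: nat where "0 < d" "real d *\<^sub>R s n \<in> M i"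
      using finite_index_sublattice_multiple[OF M] True by blast
    then show ?thesis by blast
  qed auto
  then obtain D :: "_ \<Rightarrow> _ \<Rightarrow> nat" where D: "\<And>i n. 0 < D i n" "\<And>i n. i \<in> A \<Longrightarrow> n \<in> I \<Longrightarrow> real (D i n) *\<^sub>R s n \<in> M i"
    by metis
  show ?thesis
  proof (rule that[of "\<Prod>i\<in>A. \<Prod>n\<in>I. D i n"])
    show "0 < (\<Prod>i\<in>A. \<Prod>n\<in>I. D i n)" by (intro prod_pos) (use D(1) in auto)
    fix i n assume i: "i \<in> A" "n \<in> I"
    have "D i n dvd (\<Prod>n\<in>I. D i n)" using assms(1) i(2) by (rule dvd_prodI)
    also have "\<dots> dvd (\<Prod>i\<in>A. \<Prod>n\<in>I. D i n)" using assms(2) i(1) by (rule dvd_prodI)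
    finally obtain k where "(\<Prod>i\<in>A. \<Prod>n\<in>I. D i n) = D i n * k" by (rule dvdE)
    then show "real (\<Prod>i\<in>A. \<Prod>n\<in>I. D i n) *\<^sub>R s n \<in> M i"
      using finite_index_sublattice_scale[OF M[OF i(1)] D(2)[OF i], of k] by (simp add: mult.commute)
  qed
qed

lemma periodic_on_diff_const:
  assumes "periodic_on L f"
  shows "periodic_on L (\<lambda>x. f x - c)"
  using assms by (auto simp: periodic_on_def)

lemma node_lattice_closed:
  "n \<in> nodes G \<Longrightarrow> c \<in> \<int> \<Longrightarrow> c *\<^sub>R E n \<in> node_lattice G"
  "x \<in> node_lattice G \<Longrightarrow> y \<in> node_lattice G \<Longrightarrow> x - y \<in> node_lattice G"
  by (auto simp: node_lattice_def lattice_def E_nth)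

lemma finite_multi_indices: "finite (multi_indices (G :: 'v::finite plumbing_graph))"
proof -
  have "multi_indices G \<subseteq> {m. \<forall>v. m v \<in> {..card (ends G)}}"
  proof (intro subsetI CollectI allI)
    fix m v assume m: "m \<in> multi_indices G"
    show "m v \<in> {..card (ends G)}"
    proof (cases "v \<in> nodes G")
      case True
      then have "m v \<le> (\<Sum>n\<in>nodes G. m n)" by (intro member_le_sum) auto
      then show ?thesis using m by (auto simp: multi_indices_def)
    qed (use m in \<open>auto simp: multi_indices_def\<close>)
  qed
  moreover have "finite {m::'v \<Rightarrow> nat. \<forall>v. m v \<in> {..card (ends G)}}"
    using finite_PiE[of "UNIV :: 'v set" "\<lambda>_. {..card (ends G)}"] by (simp add: PiE_def Pi_def extensional_def)
  ultimately show ?thesis by (rule finite_subset)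
qed

text \<open>
  Differences of step \<open>d\<close>, a common period, see constant coefficients. The operator belonging to a
  multi-index of maximal degree with nonvanishing coefficient then isolates that coefficient.
\<close>

lemma periodic_coefficients_zero:
  fixes G :: "'v::finite plumbing_graph"
  assumes ns: "distinct ns" "set ns = nodes G"
    and periodic: "\<And>m. m \<in> multi_indices G \<Longrightarrow> periodic_on (node_lattice G) (b m)"
    and zero: "\<And>x. x \<in> node_lattice G \<Longrightarrow>
      diffs E a ns (\<lambda>x. \<Sum>m\<in>multi_indices G. b m x * prod_fun (nodes G) (\<lambda>n. divided_power (m n)) x) x = 0"
    and m: "m \<in> multi_indices G" "\<And>n. n \<in> nodes G \<Longrightarrow> a n \<le> m n" and x0: "x0 \<in> node_lattice G"
  shows "b m x0 = 0"
proof (rule ccontr)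
  assume b: "b m x0 \<noteq> 0"
  let ?MI = "multi_indices G" and ?NL = "node_lattice G" and ?N = "nodes G"
  let ?mono = "\<lambda>m. prod_fun ?N (\<lambda>n. divided_power (m n))"
  let ?s = "\<lambda>m. \<Sum>n\<in>?N. m n"
  define B where "B = {m \<in> ?MI. (\<forall>n\<in>?N. a n \<le> m n) \<and> b m x0 \<noteq> 0}"
  have "finite B" by (rule finite_subset[OF _ finite_multi_indices]) (auto simp: B_def)
  moreover have "B \<noteq> {}" using m b by (auto simp: B_def)
  ultimately have "Max (?s ` B) \<in> ?s ` B" by (intro Max_in) auto
  then obtain m0 where m0: "m0 \<in> B" "Max (?s ` B) = ?s m0" by blast
  have max: "?s m' \<le> ?s m0" if "m' \<in> B" for m'
    unfolding m0(2)[symmetric] using \<open>finite B\<close> that by (intro Max_ge) auto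
  obtain M where M: "finite_index_sublattice (M m) ?NL" "\<forall>x\<in>?NL. \<forall>y\<in>M m. b m (x + y) = b m x" if "m \<in> ?MI" for m
    using periodic unfolding periodic_on_def by metis
  obtain d :: nat where d: "0 < d" "\<And>m n. m \<in> ?MI \<Longrightarrow> n \<in> ?N \<Longrightarrow> real d *\<^sub>R E n \<in> M m"
  proof (rule finite_index_common_multiple[of ?N ?MI M ?NL E])
    show "finite ?MI" by (rule finite_multi_indices)
    show "finite_index_sublattice (M i) ?NL" if "i \<in> ?MI" for i using M that by blast
    show "real t *\<^sub>R E n \<in> ?NL" if "n \<in> ?N" for n t using that by (intro node_lattice_closed) auto
  qed auto
  let ?D = "diffs (\<lambda>n. real d *\<^sub>R E n) m0 ns"
  let ?h = "\<lambda>x. \<Sum>m\<in>?MI. b m x * ?mono m x"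
  let ?g = "\<lambda>x. \<Sum>m\<in>?MI. b m x0 * ?mono m x"
  \<comment> \<open>All coefficients are frozen at their values at \<open>x0\<close>. This set
    contains \<open>x0\<close> and is stable under steps of length \<open>d\<close>, so the
    differences at \<open>x0\<close> see only the polynomial \<open>?g\<close>.\<close>
  define S where "S = {x \<in> ?NL. \<forall>m\<in>?MI. b m x = b m x0}"
  have closed: "x - real d *\<^sub>R E n \<in> S" if "x \<in> S" "n \<in> ?N" for x n
  proof -
    have x: "x - real d *\<^sub>R E n \<in> ?NL"
      using that by (intro node_lattice_closed) (auto simp: S_def)
    have "b m (x - real d *\<^sub>R E n) = b m x" if m: "m \<in> ?MI" for m
      using M(2)[OF m] x d(2)[OF m \<open>n \<in> ?N\<close>] by fastforce
    then show ?thesis using x that by (auto simp: S_def)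
  qed
  have h0: "diffs (\<lambda>n. real d *\<^sub>R E n) a ns ?h x = 0" if "x \<in> ?NL" for x
  proof (rule diffs_scale_zero_on[of ?NL])
    show "x - E n \<in> ?NL" if "x \<in> ?NL" "n \<in> set ns" for x n
      using that ns node_lattice_closed(1)[of n G 1] by (intro node_lattice_closed(2)) auto
  qed (use zero that in auto)
  have "?D ?h x0 = 0"
  proof (rule diffs_mono_zero_on[of ?NL])
    show "x - real d *\<^sub>R E n \<in> ?NL" if "x \<in> ?NL" "n \<in> set ns" for x n
      using that ns by (intro node_lattice_closed) auto
  qed (use h0 x0 m0 ns in \<open>auto simp: B_def\<close>)
  also have "?D ?h x0 = ?D ?g x0"
    by (rule diffs_cong_on[of S]) (use closed ns x0 in \<open>auto simp: S_def\<close>)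
  also have "\<dots> = (\<Sum>m\<in>?MI. b m x0 * ?D (?mono m) x0)"
    by (simp add: diffs_sum)
  also have "\<dots> = (\<Sum>m\<in>?MI. b m x0 * (\<Prod>n\<in>?N. (nab (real d) ^^ m0 n) (divided_power (m n)) (x0 $ n)))"
    using ns by (simp add: diffs_prod_fun prod_fun_def)
  also have "\<dots> = (\<Sum>m\<in>{m0}. b m x0 * (\<Prod>n\<in>?N. (nab (real d) ^^ m0 n) (divided_power (m n)) (x0 $ n)))"
  proof (rule sum.mono_neutral_right)
    show "finite ?MI" by (rule finite_multi_indices)
    show "{m0} \<subseteq> ?MI" using m0 by (auto simp: B_def)
    show "\<forall>m\<in>?MI - {m0}. b m x0 * (\<Prod>n\<in>?N. (nab (real d) ^^ m0 n) (divided_power (m n)) (x0 $ n)) = 0"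
    proof (rule ballI, rule ccontr)
      fix m assume m: "m \<in> ?MI - {m0}" and nz: "b m x0 * (\<Prod>n\<in>?N. (nab (real d) ^^ m0 n) (divided_power (m n)) (x0 $ n)) \<noteq> 0"
      \<comment> \<open>More differences than the exponent give 0, so a nonzero term has
        \<open>m \<ge> m0\<close> at every node. Then \<open>m\<close> lies in \<open>B\<close>, and
        the maximal degree of \<open>m0\<close> forces \<open>m = m0\<close>.\<close>
      then have ge: "m0 n \<le> m n" if "n \<in> ?N" for n
        using that nab_pow_divided_power_less[of "m n" "m0 n"] by (force simp: not_le[symmetric])
      then have "m \<in> B" using m nz m0 by (fastforce simp: B_def intro: order_trans)
      from max[OF this] have "?s m \<le> ?s m0" .
      moreover have "?s m0 \<le> ?s m" using ge by (rule sum_mono)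
      ultimately have "?s m = ?s m0" by simp
      then have "m n = m0 n" if "n \<in> ?N" for n
        using ge that sum_strict_mono_ex1[of ?N m0 m] by (metis finite le_neq_implies_less less_irrefl)
      moreover have "m n = m0 n" if "n \<notin> ?N" for n
        using that m m0 by (auto simp: multi_indices_def B_def)
      ultimately have "m = m0" by blast
      then show False using m by simp
    qed
  qed
  also have "\<dots> \<noteq> 0"
    using m0 d(1) by (simp add: nab_pow_divided_power_self B_def)
  finally show False by simp
qed

section \<open>Multi-indices just above the base index\<close>

definition base_plus :: "'v::finite plumbing_graph \<Rightarrow> 'v \<Rightarrow> 'v \<Rightarrow> nat" where
  "base_plus G n q = base_index G q + (if q = n then 1 else 0)"

text \<open>The case \<open>n = k\<close> is allowed and raises one entry by 2. Swapping
  \<open>n\<close> and \<open>k\<close> gives the same index, so an off-diagonal index arises from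
  two ordered pairs.\<close>

definition base_plus2 :: "'v::finite plumbing_graph \<Rightarrow> 'v \<Rightarrow> 'v \<Rightarrow> 'v \<Rightarrow> nat" where
  "base_plus2 G n k q = base_index G q + (if q = n then 1 else 0) + (if q = k then 1 else 0)"

lemma sum_base_plus:
  "n \<in> nodes G \<Longrightarrow> (\<Sum>q\<in>nodes G. base_plus G n q) = (\<Sum>q\<in>nodes G. base_index G q) + 1"
  "n \<in> nodes G \<Longrightarrow> k \<in> nodes G \<Longrightarrow> (\<Sum>q\<in>nodes G. base_plus2 G n k q) = (\<Sum>q\<in>nodes G. base_index G q) + 2"
  by (simp_all add: base_plus_def base_plus2_def sum.distrib)

lemma base_indices_distinct:
  assumes "n \<in> nodes G"
  shows "base_plus G n \<noteq> base_index G"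
    and "k \<in> nodes G \<Longrightarrow> base_plus2 G n k \<noteq> base_index G"
    and "k \<in> nodes G \<Longrightarrow> j \<in> nodes G \<Longrightarrow> base_plus2 G n k \<noteq> base_plus G j"
proof -
  show "base_plus G n \<noteq> base_index G"
    using sum_base_plus(1)[OF assms] by auto
  show "base_plus2 G n k \<noteq> base_index G" if "k \<in> nodes G"
    using sum_base_plus(2)[OF assms that] by auto
  show "base_plus2 G n k \<noteq> base_plus G j" if "k \<in> nodes G" "j \<in> nodes G"
  proof
    assume "base_plus2 G n k = base_plus G j"
    then show False using sum_base_plus(2)[OF assms that(1)] sum_base_plus(1)[OF that(2)] by simp
  qed
qed

lemma base_plus_eq_iff: "base_plus G n = base_plus G n' \<longleftrightarrow> n = n'"
  by (auto simp: base_plus_def fun_eq_iff split: if_splits)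

lemma base_plus2_eq_iff:
  "base_plus2 G n k = base_plus2 G n' k' \<longleftrightarrow> n = n' \<and> k = k' \<or> n = k' \<and> k = n'"
proof
  assume eq: "base_plus2 G n k = base_plus2 G n' k'"
  have 1: "base_plus2 G n k n = base_plus2 G n' k' n" and 2: "base_plus2 G n k k = base_plus2 G n' k' k"
    using eq by simp_all
  have "n = n' \<or> n = k'"
    by (rule ccontr) (use 1 in \<open>simp add: base_plus2_def\<close>)
  then show "n = n' \<and> k = k' \<or> n = k' \<and> k = n'"
  proof
    assume n: "n = n'"
    have "k = k'" by (rule ccontr) (use 2 in \<open>simp add: base_plus2_def n\<close>)
    with n show ?thesis by blast
  next
    assume n: "n = k'"
    have "k = n'" by (rule ccontr) (use 2 in \<open>simp add: base_plus2_def n\<close>)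
    with n show ?thesis by blast
  qed
next
  assume "n = n' \<and> k = k' \<or> n = k' \<and> k = n'"
  then show "base_plus2 G n k = base_plus2 G n' k'"
    by (intro ext) (elim disjE conjE; hypsubst; simp only: base_plus2_def add_ac)
qed

text \<open>The differences shift \<open>x n\<close> to \<open>x n - a n / 2\<close>. The correction
  in the linear coefficient cancels the mixed terms in \<open>x\<close> and \<open>a\<close>, and
  the sum of \<open>a n * a k * J n k\<close> is left with \<open>1/8 - 1/4 = - 1/8\<close>.\<close>

lemma quadratic_sum_identity:
  fixes J :: "'v \<Rightarrow> 'v \<Rightarrow> real"
  assumes "finite N" and sym: "\<And>n k. J n k = J k n"
  shows "(\<Sum>n\<in>N. \<Sum>k\<in>N. J n k * (x n - a n / 2) * (x k - a k / 2) / 2)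
      + (\<Sum>n\<in>N. (\<beta> n + (\<Sum>q\<in>N. a q * J n q) / 2) * (x n - a n / 2))
    = (\<Sum>n\<in>N. \<Sum>k\<in>N. J n k * x n * x k) / 2 + (\<Sum>n\<in>N. \<beta> n * x n)
      - (\<Sum>n\<in>N. a n * \<beta> n) / 2 - (\<Sum>n\<in>N. \<Sum>k\<in>N. a n * a k * J n k) / 8"
proof -
  define XX XA AA where "XX = (\<Sum>n\<in>N. \<Sum>k\<in>N. J n k * x n * x k)"
    and "XA = (\<Sum>n\<in>N. \<Sum>k\<in>N. x n * (a k * J n k))"
    and "AA = (\<Sum>n\<in>N. \<Sum>k\<in>N. a n * (a k * J n k))"
  have XA': "(\<Sum>n\<in>N. \<Sum>k\<in>N. a n * x k * J n k) = XA"
    unfolding XA_def by (subst sum.swap) (simp add: sym mult_ac)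
  have "(\<Sum>n\<in>N. \<Sum>k\<in>N. J n k * (x n - a n / 2) * (x k - a k / 2) / 2)
      = (\<Sum>n\<in>N. \<Sum>k\<in>N. J n k * x n * x k / 2 - x n * (a k * J n k) / 4 - a n * x k * J n k / 4
          + a n * (a k * J n k) / 8)"
    by (intro sum.cong refl) (simp add: field_simps)
  also have "\<dots> = XX / 2 - XA / 4 - XA / 4 + AA / 8"
    by (simp only: sum.distrib sum_subtractf sum_divide_distrib[symmetric] XA' XX_def XA_def[symmetric] AA_def)
  finally have 1: "(\<Sum>n\<in>N. \<Sum>k\<in>N. J n k * (x n - a n / 2) * (x k - a k / 2) / 2)
      = XX / 2 - XA / 2 + AA / 8" by simp
  have "(\<Sum>n\<in>N. (\<beta> n + (\<Sum>q\<in>N. a q * J n q) / 2) * (x n - a n / 2))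
     = (\<Sum>n\<in>N. \<beta> n * x n - a n * \<beta> n / 2 + (\<Sum>q\<in>N. x n * (a q * J n q)) / 2 - (\<Sum>q\<in>N. a n * (a q * J n q)) / 4)"
    unfolding sum_distrib_left[symmetric] by (intro sum.cong refl) (simp add: field_simps)
  also have "\<dots> = (\<Sum>n\<in>N. \<beta> n * x n) - (\<Sum>n\<in>N. a n * \<beta> n) / 2 + XA / 2 - AA / 4"
    by (simp only: sum.distrib sum_subtractf sum_divide_distrib[symmetric] XA_def AA_def)
  finally show ?thesis using 1 by (simp add: XX_def AA_def mult.assoc)
qed

context unimodular_tree
begin

text \<open>A tree has one edge fewer than vertices, so the valencies add up to
  \<open>2 * CARD('v) - 2\<close>. Consequently the indices two above the base index just fit the
  degree bound of \<open>multi_indices\<close>.\<close>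

lemma sum_base_index:
  assumes "nodes G \<noteq> {}"
  shows "(\<Sum>n\<in>nodes G. base_index G n) + 2 = card (ends G)"
proof -
  fix r :: 'v
  have "(\<Sum>u\<in>UNIV. valency G u) + 2 = 2 * CARD('v)"
    using sum_degrees_rooted_tree[of "adj G" r UNIV] rooted_tree_UNIV[OF tree, of r] tree
    by (simp add: is_tree_def valency_def)
  moreover have "(\<Sum>u\<in>UNIV. valency G u) + (\<Sum>u\<in>UNIV. if u \<in> ends G then 1 else 0)
     = (\<Sum>u\<in>UNIV. (if u \<in> nodes G then base_index G u else 0) + 2)"
    unfolding sum.distrib[symmetric]
  proof (rule sum.cong[OF refl])
    fix u
    show "valency G u + (if u \<in> ends G then 1 else 0) = (if u \<in> nodes G then base_index G u else 0) + 2"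
      using valency_pos[OF assms, of u] by (auto simp: nodes_def ends_def base_index_def)
  qed
  moreover have "\<dots> = (\<Sum>n\<in>nodes G. base_index G n) + 2 * CARD('v)"
    by (subst sum.distrib) (simp add: sum.If_cases)
  moreover have "(\<Sum>u\<in>(UNIV :: 'v set). if u \<in> ends G then 1 else 0) = card (ends G)"
    by (simp add: sum.If_cases)
  ultimately show ?thesis by linarith
qed

text \<open>The passage from node coordinates to the lattice sends \<open>E n\<close> to
  \<open>Estar G n\<close> and so intertwines the two kinds of differences.\<close>

lemma restrict_diffs:
  assumes "set ns \<subseteq> nodes G"
  shows "restrict_to_nodes G (diffs (Estar G) m ns f) = diffs E m ns (restrict_to_nodes G f)"
  using assms
proof (induction ns)
  case Nil
  then show ?case by simp
next
  case (Cons n ns)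
  have nab: "restrict_to_nodes G (nab (Estar G n) f) = nab (E n) (restrict_to_nodes G f)" for f
  proof -
    have "(\<Sum>k\<in>nodes G. (x - E n) $ k *\<^sub>R Estar G k) = (\<Sum>k\<in>nodes G. x $ k *\<^sub>R Estar G k) - Estar G n" for x
      using Cons.prems
      by (simp add: scaleR_left_diff_distrib sum_subtractf E_nth if_distrib[of "\<lambda>c. c *\<^sub>R _"] cong: if_cong)
    then show ?thesis by (simp add: fun_eq_iff restrict_to_nodes_def nab_def)
  qed
  have "restrict_to_nodes G ((nab (Estar G n) ^^ j) f) = (nab (E n) ^^ j) (restrict_to_nodes G f)" for j f
    by (induction j) (auto simp: nab)
  then show ?case using Cons by simp
qed

lemma J_sym: "J G n k = J G k n"
  by (simp add: J_def form_sym)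

lemma chi_sum_Estar:
  "chi G (\<Sum>n\<in>A. x n *\<^sub>R Estar G n)
    = (\<Sum>n\<in>A. \<Sum>k\<in>A. J G n k * x n * x k) / 2 + (\<Sum>n\<in>A. - form G (canonical_class G) (Estar G n) / 2 * x n)"
  unfolding chi_def form_sum_left form_sum_right form_scale_left form_scale_right J_def
  by (simp add: sum_negf sum_divide_distrib[symmetric] sum_distrib_left[symmetric] field_simps,
      intro sum.cong arg_cong2[where f = "(*)"] refl, rule form_sym)

end

theorem theorem8p2p2:
  fixes G :: "'v::finite plumbing_graph"
    and C :: "(real ^ 'v) set"
    and LC :: "real ^ 'v \<Rightarrow> real"
    and a :: "('v \<Rightarrow> nat) \<Rightarrow> real ^ 'v \<Rightarrow> real"
  assumes "is_tree G"
    and "negative_definite G"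
    and "det (- intersection_matrix G) = 1"
    and "nodes G \<noteq> {}"
    and "is_chamber G C"
    and "interior (C \<inter> lipman_cone G) \<noteq> {}"
    and "is_ehrhart_quasipolynomial G C LC"
    and "normalized_coefficients G (restrict_to_nodes G LC) a"
  shows "\<forall>x \<in> node_lattice G.
    (\<forall>n \<in> nodes G.
       a ((base_index G)(n := valency G n)) x = J G n n) \<and>
    (\<forall>n \<in> nodes G. \<forall>m \<in> nodes G. m \<noteq> n \<longrightarrow>
       a ((base_index G)(n := valency G n - 1, m := valency G m - 1)) x = J G n m) \<and>
    (\<forall>n \<in> nodes G.
       a ((base_index G)(n := valency G n - 1)) x =
         - 1 / 2 * form G (canonical_class G) (Estar G n)
         + 1 / 2 * (\<Sum>q\<in>nodes G. (real (valency G q) - 2) * J G n q)) \<and>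
    a (base_index G) x =
      periodic_constant (lipman_cone G) (Z_coeff G)
      - (\<Sum>n\<in>nodes G. (real (valency G n) - 2) * form G (canonical_class G) (Estar G n) / 4)
      + (\<Sum>n\<in>nodes G. (real (valency G n) - 2) * (3 * real (valency G n) - 7) * J G n n / 24)
      + (\<Sum>n\<in>nodes G. \<Sum>m\<in>nodes G - {n}.
           (real (valency G n) - 2) * (real (valency G m) - 2) * J G n m / 8)"
proof -
  interpret unimodular_tree G using assms(1-3) by unfold_locales
  let ?N = "nodes G" and ?MI = "multi_indices G" and ?NL = "node_lattice G"
  let ?mono = "\<lambda>m. prod_fun ?N (\<lambda>n. divided_power (m n))"
  let ?b = "base_index G"
  obtain ns where ns: "distinct ns" "set ns = ?N" using finite_distinct_list[of ?N] by auto
  define pc where "pc = periodic_constant (lipman_cone G) (Z_coeff G)"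
  define \<alpha> where "\<alpha> n = real (?b n)" for n
  define \<beta> where "\<beta> n = - form G (canonical_class G) (Estar G n) / 2" for n
  \<comment> \<open>Halved off the diagonal, because both orders of the pair contribute to the same
    index and add up to \<open>J G n k\<close>.\<close>
  define w2 where "w2 n k = (if n = k then J G n n else J G n k / 2)" for n k
  \<comment> \<open>The second term of \<open>w1\<close> and the first two sums of \<open>w0\<close>
    compensate the shift by \<open>\<alpha> n / 2\<close>; the last sum of \<open>w0\<close>
    compensates the \<open>\<alpha> n / 24\<close> produced by the diagonal quadratic terms.\<close>
  define w1 where "w1 n = \<beta> n + (\<Sum>q\<in>?N. \<alpha> q * J G n q) / 2" for n
  define w0 where "w0 = pc + (\<Sum>n\<in>?N. \<alpha> n * \<beta> n) / 2 + (\<Sum>n\<in>?N. \<Sum>k\<in>?N. \<alpha> n * \<alpha> k * J G n k) / 8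
    - (\<Sum>n\<in>?N. J G n n * \<alpha> n / 24)"
  \<comment> \<open>A polynomial whose base differences are \<open>chi + pc\<close>. Its remaining
    coefficients are set to 0: monomials with an entry below the base index are annihilated by the
    differences, so nothing is claimed about their coefficients in \<open>a\<close>.\<close>
  define c where "c m = (\<Sum>n\<in>?N. \<Sum>k\<in>?N. if m = base_plus2 G n k then w2 n k else 0)
    + (\<Sum>n\<in>?N. if m = base_plus G n then w1 n else 0) + (if m = ?b then w0 else 0)" for m
  have \<alpha>: "\<alpha> n = real (valency G n) - 2" if "n \<in> ?N" for n
    using that by (auto simp: \<alpha>_def base_index_def nodes_def)
  have in_MI: "?b \<in> ?MI" "\<And>n. n \<in> ?N \<Longrightarrow> base_plus G n \<in> ?MI"
    "\<And>n k. n \<in> ?N \<Longrightarrow> k \<in> ?N \<Longrightarrow> base_plus2 G n k \<in> ?MI"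
    using sum_base_index[OF assms(4)] sum_base_plus[of _ G]
    by (auto simp: multi_indices_def base_plus_def base_plus2_def base_index_def)
  define R where "R m x = (\<Prod>n\<in>?N. (nab 1 ^^ ?b n) (divided_power (m n)) (x $ n))" for m and x :: "real ^ 'v"
  have R0: "R ?b x = 1" for x
    by (simp add: R_def nab_pow_divided_power_self)
  have R1: "R (base_plus G n) x = x $ n - \<alpha> n / 2" if "n \<in> ?N" for n x
  proof -
    have "R (base_plus G n) x = (\<Prod>q\<in>?N. if q = n then x $ n - \<alpha> n / 2 else 1)"
      unfolding R_def
      by (rule prod.cong) (auto simp: base_plus_def nab_pow_divided_power_self nab_pow_divided_power_Suc \<alpha>_def)
    then show ?thesis using that by simp
  qed
  have R2: "R (base_plus2 G n k) x = (if n = k then (x $ n - \<alpha> n / 2)\<^sup>2 / 2 + \<alpha> n / 24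
      else (x $ n - \<alpha> n / 2) * (x $ k - \<alpha> k / 2))" if "n \<in> ?N" "k \<in> ?N" for n k x
  proof (cases "n = k")
    case True
    have "R (base_plus2 G n k) x = (\<Prod>q\<in>?N. if q = n then (x $ n - \<alpha> n / 2)\<^sup>2 / 2 + \<alpha> n / 24 else 1)"
      unfolding R_def
      by (rule prod.cong) (auto simp: True base_plus2_def nab_pow_divided_power_self nab_pow_divided_power_Suc_Suc \<alpha>_def)
    then show ?thesis using that True by simp
  next
    case False
    have "R (base_plus2 G n k) x
      = (\<Prod>q\<in>?N. (if q = n then x $ n - \<alpha> n / 2 else 1) * (if q = k then x $ k - \<alpha> k / 2 else 1))"
      unfolding R_def
      by (rule prod.cong) (use False in \<open>auto simp: base_plus2_def nab_pow_divided_power_self nab_pow_divided_power_Suc \<alpha>_def\<close>)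
    then show ?thesis using that False by (simp add: prod.distrib)
  qed
  have diffs_mono: "diffs E ?b ns (?mono m) x = R m x" for m x
    using diffs_prod_fun[of ns ?N 1 ?b "\<lambda>n. divided_power (m n)"] ns by (simp add: R_def prod_fun_def)
  have pick: "(\<Sum>m\<in>?MI. (if m = i then w else 0) * R m x) = w * R i x" if "i \<in> ?MI" for i w x
    using that finite_multi_indices[of G] by (simp add: if_distrib[of "\<lambda>t. t * _"] cong: if_cong)
  have P: "diffs E ?b ns (\<lambda>x. \<Sum>m\<in>?MI. c m * ?mono m x) x
      = chi G (\<Sum>n\<in>?N. x $ n *\<^sub>R Estar G n) + pc" for x
  proof -
    let ?y = "\<lambda>n. x $ n - \<alpha> n / 2"
    have "diffs E ?b ns (\<lambda>x. \<Sum>m\<in>?MI. c m * ?mono m x) x = (\<Sum>m\<in>?MI. c m * R m x)"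
      by (simp add: diffs_sum diffs_mono)
    also have "\<dots> = (\<Sum>m\<in>?MI. \<Sum>n\<in>?N. \<Sum>k\<in>?N. (if m = base_plus2 G n k then w2 n k else 0) * R m x)
      + (\<Sum>m\<in>?MI. \<Sum>n\<in>?N. (if m = base_plus G n then w1 n else 0) * R m x)
      + (\<Sum>m\<in>?MI. (if m = ?b then w0 else 0) * R m x)"
      by (simp only: c_def distrib_right sum.distrib sum_distrib_right)
    also have "(\<Sum>m\<in>?MI. \<Sum>n\<in>?N. \<Sum>k\<in>?N. (if m = base_plus2 G n k then w2 n k else 0) * R m x)
      = (\<Sum>n\<in>?N. \<Sum>k\<in>?N. w2 n k * R (base_plus2 G n k) x)"
      by (subst sum.swap, intro sum.cong refl, subst sum.swap, intro sum.cong refl) (simp only: pick in_MI)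
    also have "\<dots> = (\<Sum>n\<in>?N. \<Sum>k\<in>?N. J G n k * ?y n * ?y k / 2 + (if k = n then J G n n * \<alpha> n / 24 else 0))"
      by (intro sum.cong refl) (auto simp: R2 w2_def power2_eq_square field_simps)
    also have "\<dots> = (\<Sum>n\<in>?N. \<Sum>k\<in>?N. J G n k * ?y n * ?y k / 2) + (\<Sum>n\<in>?N. J G n n * \<alpha> n / 24)"
      by (simp add: sum.distrib)
    also have "(\<Sum>m\<in>?MI. \<Sum>n\<in>?N. (if m = base_plus G n then w1 n else 0) * R m x)
      = (\<Sum>n\<in>?N. (\<beta> n + (\<Sum>q\<in>?N. \<alpha> q * J G n q) / 2) * ?y n)"
      by (subst sum.swap, intro sum.cong refl) (simp only: pick in_MI R1 w1_def)
    also have "(\<Sum>m\<in>?MI. (if m = ?b then w0 else 0) * R m x) = w0"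
      using pick[OF in_MI(1)] R0 by simp
    finally show ?thesis
      using quadratic_sum_identity[of ?N "J G" "\<lambda>n. x $ n" \<alpha> \<beta>, OF _ J_sym]
      by (simp add: w0_def chi_sum_Estar \<beta>_def)
  qed
  have L: "diffs E ?b ns (restrict_to_nodes G LC) x = chi G (\<Sum>n\<in>?N. x $ n *\<^sub>R Estar G n) + pc"
    if x: "x \<in> ?NL" for x
  proof -
    have "(\<Sum>n\<in>?N. x $ n *\<^sub>R Estar G n) \<in> lattice"
      using x by (intro lattice_sum lattice_scale Estar_lattice) (auto simp: node_lattice_def lattice_def)
    from diffs_ehrhart_quasipolynomial[OF assms(4-7) ns this]
    have "restrict_to_nodes G (diffs (Estar G) (\<lambda>n. valency G n - 2) ns LC) x
        = chi G (\<Sum>n\<in>?N. x $ n *\<^sub>R Estar G n) + pc"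
      by (simp add: restrict_to_nodes_def pc_def)
    moreover have "diffs E (\<lambda>n. valency G n - 2) ns f = diffs E ?b ns f" for f :: "real ^ 'v \<Rightarrow> real"
      unfolding diffs_def by (rule foldr_cong) (auto simp: ns base_index_def)
    ultimately show ?thesis using restrict_diffs[of ns] ns by simp
  qed
  have hat: "restrict_to_nodes G LC x = (\<Sum>m\<in>?MI. a m x * ?mono m x)" if "x \<in> ?NL" for x
    using assms(8) that by (simp add: normalized_coefficients_def prod_fun_def divided_power_def)
  \<comment> \<open>The coefficients \<open>a m x - c m\<close> are again periodic, and the
    expression formed with them is annihilated by the base differences, since both parts are sent to
    \<open>chi + pc\<close> on the node lattice.\<close>
  have a_eq_c: "a m x = c m" if m: "m \<in> ?MI" "\<And>n. n \<in> ?N \<Longrightarrow> ?b n \<le> m n" and x: "x \<in> ?NL" for m x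
  proof -
    have "a m x - c m = 0"
    proof (rule periodic_coefficients_zero[OF ns, of "\<lambda>m x. a m x - c m" ?b])
      show "periodic_on ?NL (\<lambda>x. a m x - c m)" if "m \<in> ?MI" for m
        using assms(8) that by (intro periodic_on_diff_const) (simp add: normalized_coefficients_def)
      fix x assume x: "x \<in> ?NL"
      have "diffs E ?b ns (\<lambda>x. \<Sum>m\<in>?MI. (a m x - c m) * ?mono m x) x
          = diffs E ?b ns (\<lambda>x. restrict_to_nodes G LC x - (\<Sum>m\<in>?MI. c m * ?mono m x)) x"
      proof (rule diffs_cong_on[of ?NL])
        show "x - E n \<in> ?NL" if "x \<in> ?NL" "n \<in> set ns" for x n
          using that ns node_lattice_closed(1)[of n G 1] by (intro node_lattice_closed(2)) auto
      qed (use hat x in \<open>auto simp: left_diff_distrib sum_subtractf\<close>)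
      also have "\<dots> = 0" using P L x by (simp add: diffs_diff)
      finally show "diffs E ?b ns (\<lambda>x. \<Sum>m\<in>?MI. (a m x - c m) * ?mono m x) x = 0" .
    qed (use m x in auto)
    then show ?thesis by simp
  qed
  have c2: "c (base_plus2 G n k) = J G n k" if "n \<in> ?N" "k \<in> ?N" for n k
  proof -
    have "c (base_plus2 G n k)
        = (\<Sum>n'\<in>?N. \<Sum>k'\<in>?N. if n = n' \<and> k = k' \<or> n = k' \<and> k = n' then w2 n' k' else 0)"
      using that base_indices_distinct[of _ G] by (simp add: c_def base_plus2_eq_iff)
    \<comment> \<open>For \<open>n = k\<close> the two alternatives coincide, so the second summand
      is switched off to avoid counting the pair twice.\<close>
    also have "\<dots> = (\<Sum>n'\<in>?N. \<Sum>k'\<in>?N. (if k' = k then if n' = n then w2 n k else 0 else 0)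
        + (if k' = n then if n' = k then if n = k then 0 else w2 k n else 0 else 0))"
      by (intro sum.cong refl) auto
    also have "\<dots> = w2 n k + (if n = k then 0 else w2 k n)"
      using that by (simp add: sum.distrib)
    finally show ?thesis by (simp add: w2_def J_sym[of k n])
  qed
  have c1: "c (base_plus G n) = w1 n" if "n \<in> ?N" for n
    using that base_indices_distinct[of _ G] base_indices_distinct(3)[of _ G, symmetric]
    by (simp add: c_def base_plus_eq_iff)
  have c0: "c ?b = w0"
    using base_indices_distinct[of _ G, symmetric] by (simp add: c_def)
  have w0: "w0 = pc - (\<Sum>n\<in>?N. (real (valency G n) - 2) * form G (canonical_class G) (Estar G n) / 4)
      + (\<Sum>n\<in>?N. (real (valency G n) - 2) * (3 * real (valency G n) - 7) * J G n n / 24)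
      + (\<Sum>n\<in>?N. \<Sum>m\<in>?N - {n}. (real (valency G n) - 2) * (real (valency G m) - 2) * J G n m / 8)"
  proof -
    have "(\<Sum>n\<in>?N. \<alpha> n * \<beta> n) / 2
        = - (\<Sum>n\<in>?N. (real (valency G n) - 2) * form G (canonical_class G) (Estar G n) / 4)"
      by (simp add: sum_divide_distrib sum_negf[symmetric] \<alpha> \<beta>_def)
    moreover have "(\<Sum>n\<in>?N. \<Sum>k\<in>?N. \<alpha> n * \<alpha> k * J G n k) / 8
        = (\<Sum>n\<in>?N. \<alpha> n * \<alpha> n * J G n n / 8
            + (\<Sum>m\<in>?N - {n}. (real (valency G n) - 2) * (real (valency G m) - 2) * J G n m / 8))"
      unfolding sum_divide_distrib
      by (intro sum.cong refl, subst sum.remove) (auto simp: \<alpha>)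
    \<comment> \<open>The diagonal terms combine to \<open>\<alpha>^2 / 8 - \<alpha> / 24 = \<alpha>
      (3 \<alpha> - 1) / 24\<close>, and for a node of valency \<open>\<delta>\<close> one has
      \<open>3 \<alpha> - 1 = 3 \<delta> - 7\<close>.\<close>
    moreover have "(\<Sum>n\<in>?N. \<alpha> n * \<alpha> n * J G n n / 8) - (\<Sum>n\<in>?N. J G n n * \<alpha> n / 24)
        = (\<Sum>n\<in>?N. (real (valency G n) - 2) * (3 * real (valency G n) - 7) * J G n n / 24)"
      unfolding sum_subtractf[symmetric] by (intro sum.cong refl) (simp add: \<alpha> field_simps)
    ultimately show ?thesis unfolding w0_def sum.distrib by linarith
  qed
  have w1: "w1 n = - 1 / 2 * form G (canonical_class G) (Estar G n)
      + 1 / 2 * (\<Sum>q\<in>?N. (real (valency G q) - 2) * J G n q)" for n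
    by (simp add: w1_def \<beta>_def \<alpha>)
  have idx: "?b(n := valency G n) = base_plus2 G n n" "?b(n := valency G n - 1) = base_plus G n"
    if "n \<in> ?N" for n
    using that by (auto simp: base_plus_def base_plus2_def fun_eq_iff base_index_def nodes_def)
  have idx2: "?b(n := valency G n - 1, m := valency G m - 1) = base_plus2 G n m"
    if "n \<in> ?N" "m \<in> ?N" "m \<noteq> n" for n m
    using that by (auto simp: base_plus2_def fun_eq_iff base_index_def nodes_def)
  show ?thesis
  proof (intro ballI conjI impI)
    fix x assume x: "x \<in> ?NL"
    show "a (?b(n := valency G n)) x = J G n n" if "n \<in> ?N" for n
      using a_eq_c[OF in_MI(3)[OF that that] _ x] c2[OF that that] idx(1)[OF that]
      by (simp add: base_plus2_def)
    show "a (?b(n := valency G n - 1, m := valency G m - 1)) x = J G n m"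
      if "n \<in> ?N" "m \<in> ?N" "m \<noteq> n" for n m
      using a_eq_c[OF in_MI(3)[OF that(1,2)] _ x] c2[OF that(1,2)] idx2[OF that]
      by (simp add: base_plus2_def)
    show "a (?b(n := valency G n - 1)) x = - 1 / 2 * form G (canonical_class G) (Estar G n)
      + 1 / 2 * (\<Sum>q\<in>?N. (real (valency G q) - 2) * J G n q)" if "n \<in> ?N" for n
      using a_eq_c[OF in_MI(2)[OF that] _ x] c1[OF that] idx(2)[OF that] w1
      by (simp add: base_plus_def)
    show "a ?b x = periodic_constant (lipman_cone G) (Z_coeff G)
      - (\<Sum>n\<in>?N. (real (valency G n) - 2) * form G (canonical_class G) (Estar G n) / 4)
      + (\<Sum>n\<in>?N. (real (valency G n) - 2) * (3 * real (valency G n) - 7) * J G n n / 24)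
      + (\<Sum>n\<in>?N. \<Sum>m\<in>?N - {n}. (real (valency G n) - 2) * (real (valency G m) - 2) * J G n m / 8)"
      using a_eq_c[OF in_MI(1) _ x] c0 w0 by (simp add: pc_def)
  qed
qed

end
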